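(* Let $q$ be a prime power, $n\ge 2$, $K=\mathbb{F}_{q^n}$, $F=K(x)$ and $E=F(y)$ with $$y^{q^{n-1}}+y^{q^{n-2}}+\dots+y^q+y=s_{n,2}(x).$$ For every pair $(\tau,\delta)\in K^2$ with $\delta^{q^{n-1}}+\dots+\delta^q+\delta=s_{n,2}(\tau)$ there is a $K$-automorphism $\sigma_{\tau,\delta}$ of $E$ given by $$\sigma(x)=x+\tau,\qquad \sigma(y)=y+x\bigl(\tau^{q}+\tau^{q^2}+\dots+\tau^{q^{n-1}}\bigr)+\delta .$$ These automorphisms map $F$ onto itself and form a subgroup $\Gamma$ of $\mathrm{Aut}(E/K)$ of order $q^{2n-1}$, and $\Gamma$ acts transitively on the set of places of degree one of $E$ other than the unique place lying over the pole of $x$.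
   Context: For a prime power $q$, $s_{n,2}(t)=\sum_{0\le j<k\le n-1}t^{q^j+q^k}$ is the second $(n,q)$-elementary symmetric polynomial (the second elementary symmetric polynomial in $n$ variables evaluated at $(t,t^q,\dots,t^{q^{n-1}})$). *)

theory Defs
  imports "HOL-Computational_Algebra.Polynomial" "HOL-Computational_Algebra.Fraction_Field"
          "HOL-Computational_Algebra.Primes"
begin

text \<open>Second (n,q)-elementary symmetric polynomial evaluated at t.\<close>
definition s_n2 :: "nat \<Rightarrow> nat \<Rightarrow> 'a::comm_ring_1 \<Rightarrow> 'a" where
  "s_n2 q n t = (\<Sum>k<n. \<Sum>j<k. t ^ (q ^ j + q ^ k))"

definition addtr :: "nat \<Rightarrow> nat \<Rightarrow> 'a::comm_ring_1 \<Rightarrow> 'a" where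
  "addtr q n z = (\<Sum>i<n. z ^ (q ^ i))"

definition prime_power :: "nat \<Rightarrow> bool" where
  "prime_power q \<longleftrightarrow> (\<exists>p m. prime p \<and> m > 0 \<and> q = p ^ m)"

definition constF :: "'k::field \<Rightarrow> 'k poly fract" where
  "constF c = Fract [:c:] 1"

definition varF :: "'k::field poly fract" where
  "varF = Fract [:0, 1:] 1"

definition is_subfield :: "'a::field set \<Rightarrow> bool" where
  "is_subfield L \<longleftrightarrow> 0 \<in> L \<and> 1 \<in> L \<and>
     (\<forall>a\<in>L. \<forall>b\<in>L. a + b \<in> L \<and> a - b \<in> L \<and> a * b \<in> L) \<and>
     (\<forall>a\<in>L. inverse a \<in> L)"

text \<open>Valuation rings of a field over a constant subfield Kc (Stichtenoth, Def. 1.1.4).\<close>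
definition valuation_ring :: "'a::field set \<Rightarrow> 'a set \<Rightarrow> bool" where
  "valuation_ring Kc R \<longleftrightarrow> Kc \<subset> R \<and> R \<subset> UNIV \<and>
     0 \<in> R \<and> 1 \<in> R \<and> (\<forall>a\<in>R. \<forall>b\<in>R. a + b \<in> R \<and> a - b \<in> R \<and> a * b \<in> R) \<and>
     (\<forall>z. z \<notin> R \<longrightarrow> inverse z \<in> R)"

definition is_place :: "'a::field set \<Rightarrow> 'a set \<Rightarrow> bool" where
  "is_place Kc P \<longleftrightarrow> (\<exists>R. valuation_ring Kc R \<and> P = {z \<in> R. z = 0 \<or> inverse z \<notin> R})"

definition val_ring :: "'a::field set \<Rightarrow> 'a set" where
  "val_ring P = {z. z = 0 \<or> inverse z \<notin> P}"

text \<open>Degree one: the residue class field O_P/P equals Kc.\<close>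
definition degree_one :: "'a::field set \<Rightarrow> 'a set \<Rightarrow> bool" where
  "degree_one Kc P \<longleftrightarrow> is_place Kc P \<and> (\<forall>z\<in>val_ring P. \<exists>c\<in>Kc. z - c \<in> P)"

definition lies_over :: "('b \<Rightarrow> 'a) \<Rightarrow> 'a set \<Rightarrow> 'b set \<Rightarrow> bool" where
  "lies_over emb P Q \<longleftrightarrow> P \<inter> range emb = emb ` Q"

definition is_K_aut :: "'a::field set \<Rightarrow> ('a \<Rightarrow> 'a) \<Rightarrow> bool" where
  "is_K_aut Kc \<sigma> \<longleftrightarrow> bij \<sigma> \<and> (\<forall>a b. \<sigma> (a + b) = \<sigma> a + \<sigma> b \<and> \<sigma> (a * b) = \<sigma> a * \<sigma> b)
     \<and> \<sigma> 1 = 1 \<and> (\<forall>c\<in>Kc. \<sigma> c = c)"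

definition KE :: "('k::field poly fract \<Rightarrow> 'e) \<Rightarrow> 'e set" where
  "KE emb = range (\<lambda>c. emb (constF c))"

definition is_sigma :: "nat \<Rightarrow> nat \<Rightarrow> ('k::field poly fract \<Rightarrow> 'e::field) \<Rightarrow> 'e \<Rightarrow> 'k \<Rightarrow> 'k \<Rightarrow> ('e \<Rightarrow> 'e) \<Rightarrow> bool" where
  "is_sigma q n emb y \<tau> \<delta> \<sigma> \<longleftrightarrow> is_K_aut (KE emb) \<sigma> \<and>
     \<sigma> (emb varF) = emb varF + emb (constF \<tau>) \<and>
     \<sigma> y = y + emb varF * emb (constF (\<Sum>i\<in>{1..<n}. \<tau> ^ (q ^ i))) + emb (constF \<delta>)"

definition Gamma :: "nat \<Rightarrow> nat \<Rightarrow> ('k::field poly fract \<Rightarrow> 'e::field) \<Rightarrow> 'e \<Rightarrow> ('e \<Rightarrow> 'e) set" where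
  "Gamma q n emb y = {\<sigma>. \<exists>\<tau> \<delta>. addtr q n \<delta> = s_n2 q n \<tau> \<and> is_sigma q n emb y \<tau> \<delta> \<sigma>}"

end

theory Submission
  imports Defs
begin

text \<open>
  At a pole of \<open>x\<close>, put \<open>Y i = y ^ q ^ i - (\<Sum>j<i. x ^ (q ^ j + q ^ i))\<close>. Then
  \<open>Y (i + 1) = Y i ^ q - x ^ (1 + q ^ (i + 1))\<close>, and the defining equation says that the \<open>Y i\<close> with
  \<open>i < n\<close> sum to \<open>0\<close>. It follows that \<open>t = Y 1 - x ^ (q - 1) * Y 0\<close> satisfies
  \<open>t ^ N = - x ^ (q ^ n + 1) + lower order terms\<close> for \<open>N = q ^ (n - 1)\<close>, whatever the pole. Since
  \<open>q ^ n + 1\<close> is prime to \<open>N\<close>, the powers \<open>1, t, \<dots>, t ^ (N - 1)\<close> have distinct orders modulo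
  the orders of the elements of \<open>K(x)\<close>. Hence they form a basis of the extension, which therefore has
  degree \<open>N\<close>, and they determine the valuation, so that the pole is unique. (One exists by Chevalley's
  theorem.) As the defining polynomial is irreducible, each pair \<open>(\<tau>, \<delta>)\<close> yields an
  automorphism. The curve is smooth at its affine points, so a place of degree one
  that is not a pole of \<open>x\<close> is determined by the values of \<open>x\<close> and \<open>y\<close>; the group permutes these
  pairs of values transitively.
\<close>


section \<open>Field homomorphisms and evaluation of polynomials\<close>

text \<open>The obstacle is to find an element whose order at the pole reveals the full degree. The
  generator \<open>y\<close> does not do so for \<open>n > 2\<close>: at a pole \<open>y ^ N\<close>
  behaves like \<open>x ^ (N + q ^ (n - 2))\<close>, and this exponent shares the factor
  \<open>q ^ (n - 2)\<close> with \<open>N\<close>. In \<open>t\<close> the leading terms of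
  \<open>Y 1\<close> and \<open>x ^ (q - 1) * Y 0\<close> then cancel, down to an order that is
  \<open>1\<close> modulo \<open>N\<close>. Valuation rings are not assumed to be discrete, so there
  is no valuation to start from. That every nonzero element has an order at all, and the same one at
  each pole, is a result of the basis argument. The order of the group is a count of pairs: on
  \<open>K\<close>, \<open>addtr q n\<close> is the trace to the field with \<open>q\<close>
  elements, \<open>s_n2 q n\<close> takes its values in that field, and each of the
  \<open>q ^ n\<close> values of \<tau> therefore admits \<open>q ^ (n - 1)\<close> values of
  \<delta>. The pairs satisfy the same equation as the coordinates of the affine points, which is
  why differences of points provide the automorphisms needed for transitivity.\<close>

lemma is_subfield_diff: "is_subfield L \<Longrightarrow> a \<in> L \<Longrightarrow> b \<in> L \<Longrightarrow> a - b \<in> L"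
  unfolding is_subfield_def by blast

locale field_hom =
  fixes \<phi> :: "'a::field \<Rightarrow> 'b::field"
  assumes hom_add: "\<phi> (a + b) = \<phi> a + \<phi> b"
    and hom_mult: "\<phi> (a * b) = \<phi> a * \<phi> b"
    and hom_one: "\<phi> 1 = 1"
begin

lemma hom_zero: "\<phi> 0 = 0"
  using hom_add[of 0 0] by (metis add_cancel_left_left add_0)

lemma hom_uminus: "\<phi> (- a) = - \<phi> a"
  using hom_add[of a "- a"] by (simp add: hom_zero eq_neg_iff_add_eq_0 add.commute[of "\<phi> (- a)"])

lemma hom_diff: "\<phi> (a - b) = \<phi> a - \<phi> b"
  using hom_add[of a "- b"] by (simp add: hom_uminus)

lemma hom_eq_0_iff: "\<phi> a = 0 \<longleftrightarrow> a = 0"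
  using hom_mult[of a "inverse a"] by (cases "a = 0") (auto simp: hom_zero hom_one)

lemma hom_eq_iff: "\<phi> a = \<phi> b \<longleftrightarrow> a = b"
  using hom_eq_0_iff[of "a - b"] by (simp add: hom_diff)

lemma hom_inverse: "\<phi> (inverse a) = inverse (\<phi> a)"
proof (cases "a = 0")
  case False
  then have "\<phi> a * \<phi> (inverse a) = 1"
    by (simp add: hom_one flip: hom_mult)
  then show ?thesis
    by (simp add: inverse_unique)
qed (simp add: hom_zero)

lemma hom_power: "\<phi> (a ^ k) = \<phi> a ^ k"
  by (induction k) (simp_all add: hom_one hom_mult)

lemma hom_sum: "\<phi> (sum f A) = (\<Sum>i\<in>A. \<phi> (f i))"
  by (induction A rule: infinite_finite_induct) (simp_all add: hom_zero hom_add)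

lemma hom_of_nat: "\<phi> (of_nat k) = of_nat k"
  by (induction k) (simp_all add: hom_zero hom_one hom_add)

lemma hom_addtr: "\<phi> (addtr q n z) = addtr q n (\<phi> z)"
  by (simp add: addtr_def hom_sum hom_power)

lemma hom_s_n2: "\<phi> (s_n2 q n z) = s_n2 q n (\<phi> z)"
  by (simp add: s_n2_def hom_sum hom_power)

lemma is_subfield_range: "is_subfield (range \<phi>)"
  unfolding is_subfield_def
  by (auto simp flip: hom_zero hom_one hom_add hom_diff hom_mult hom_inverse)

lemma is_subfield_vimage: "is_subfield L \<Longrightarrow> is_subfield (\<phi> -` L)"
  unfolding is_subfield_def by (auto simp: hom_zero hom_one hom_add hom_diff hom_mult hom_inverse)

text \<open>Evaluation at \<open>y\<close> after carrying the coefficients over by \<phi>, as a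
  Horner scheme, so that the ring laws follow by induction on \<open>pCons\<close>.\<close>

definition hom_poly :: "'b \<Rightarrow> 'a poly \<Rightarrow> 'b" where
  "hom_poly y p = fold_coeffs (\<lambda>a v. \<phi> a + y * v) p 0"

lemma hom_poly_0 [simp]: "hom_poly y 0 = 0"
  by (simp add: hom_poly_def)

lemma hom_poly_pCons [simp]: "hom_poly y (pCons a p) = \<phi> a + y * hom_poly y p"
  by (cases "p = 0 \<and> a = 0") (auto simp: hom_poly_def hom_zero)

lemma hom_poly_1 [simp]: "hom_poly y 1 = 1"
  by (simp add: one_pCons hom_one)

lemma hom_poly_add: "hom_poly y (p + r) = hom_poly y p + hom_poly y r"
  by (induction p r rule: poly_induct2) (simp_all add: hom_add algebra_simps)

lemma hom_poly_smult: "hom_poly y (smult a p) = \<phi> a * hom_poly y p"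
  by (induction p) (simp_all add: hom_mult algebra_simps)

lemma hom_poly_uminus: "hom_poly y (- p) = - hom_poly y p"
  using hom_poly_smult[of y "-1" p] by (simp add: hom_uminus hom_one)

lemma hom_poly_diff: "hom_poly y (p - r) = hom_poly y p - hom_poly y r"
  using hom_poly_add[of y p "- r"] by (simp add: hom_poly_uminus)

lemma hom_poly_mult: "hom_poly y (p * r) = hom_poly y p * hom_poly y r"
  by (induction p) (simp_all add: hom_poly_add hom_poly_smult hom_zero algebra_simps)

lemma hom_poly_monom: "hom_poly y (monom a k) = \<phi> a * y ^ k"
  by (induction k) (simp_all add: monom_0 monom_Suc hom_zero)

lemma hom_poly_sum: "hom_poly y (sum f A) = (\<Sum>i\<in>A. hom_poly y (f i))"
  by (induction A rule: infinite_finite_induct) (simp_all add: hom_poly_add)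

lemma hom_poly_altdef: "hom_poly y p = (\<Sum>i\<le>degree p. \<phi> (coeff p i) * y ^ i)"
proof -
  have "hom_poly y p = hom_poly y (\<Sum>i\<le>degree p. monom (coeff p i) i)"
    by (simp add: poly_as_sum_of_monoms)
  then show ?thesis
    by (simp add: hom_poly_sum hom_poly_monom)
qed

text \<open>Dividing a polynomial of minimal degree annihilating \<open>y\<close> by \<open>p\<close> leaves a
  remainder whose value at \<open>y\<close> can be inverted by induction on the degree.\<close>

lemma hom_poly_inverse:
  assumes m: "m \<noteq> 0" "hom_poly y m = 0"
    and min: "\<And>p. p \<noteq> 0 \<Longrightarrow> hom_poly y p = 0 \<Longrightarrow> degree m \<le> degree p"
  shows "p \<noteq> 0 \<Longrightarrow> degree p < degree m \<Longrightarrow> \<exists>r. inverse (hom_poly y p) = hom_poly y r"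
proof (induction "degree p" arbitrary: p rule: less_induct)
  case less
  have yp: "hom_poly y p \<noteq> 0"
    using min[of p] less.prems by auto
  show ?case
  proof (cases "degree p = 0")
    case True
    then obtain a where "p = [:a:]"
      by (meson degree_eq_zeroE)
    then have "inverse (hom_poly y p) = hom_poly y [:inverse a:]"
      by (simp add: hom_inverse)
    then show ?thesis by blast
  next
    case False
    define s r where "s = m div p" and "r = m mod p"
    have mdec: "m = s * p + r"
      by (simp add: s_def r_def)
    have s0: "s \<noteq> 0"
      using less.prems m(1) by (simp add: s_def div_poly_eq_0_iff)
    have r0: "r \<noteq> 0"
    proof
      assume "r = 0"
      then have "hom_poly y s = 0" "degree m = degree s + degree p"
        using mdec m yp s0 less.prems by (auto simp: hom_poly_mult degree_mult_eq)
      then show False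
        using min[of s] s0 False by simp
    qed
    have deg: "degree r < degree p"
      using degree_mod_less[of p m] less.prems r0 by (auto simp: r_def)
    obtain g where g: "inverse (hom_poly y r) = hom_poly y g"
      using less.hyps[OF deg r0] deg less.prems by auto
    have yr: "hom_poly y r \<noteq> 0"
      using min[of r] r0 deg less.prems by auto
    have "hom_poly y s * hom_poly y p = - hom_poly y r"
      using m(2) mdec by (metis add_eq_0_iff add.commute hom_poly_add hom_poly_mult)
    then have "hom_poly y p * (- hom_poly y s * hom_poly y g) = 1"
      using yr by (simp add: mult.commute flip: g mult.assoc)
    then have "inverse (hom_poly y p) = hom_poly y (- s * g)"
      by (simp add: inverse_unique hom_poly_mult hom_poly_uminus)
    then show ?thesis by blast
  qed
qed

lemma is_subfield_range_hom_poly: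
  assumes "m \<noteq> 0" "hom_poly y m = 0"
  shows "is_subfield (range (hom_poly y))"
proof -
  \<comment> \<open>The name \<open>m\<close> is reused: the given annihilator is replaced by one of
    least degree, modulo which every polynomial can be reduced before it is inverted.\<close>
  obtain m where m: "m \<noteq> 0" "hom_poly y m = 0"
    and min: "\<And>p. p \<noteq> 0 \<Longrightarrow> hom_poly y p = 0 \<Longrightarrow> degree m \<le> degree p"
    using ex_has_least_nat[of "\<lambda>m. m \<noteq> 0 \<and> hom_poly y m = 0" _ degree] assms by blast
  have inv: "\<exists>r. inverse (hom_poly y p) = hom_poly y r" for p
  proof -
    have eq: "hom_poly y p = hom_poly y (p mod m)"
      using m(2) by (metis add_0 hom_poly_add hom_poly_mult mult_zero_right div_mult_mod_eq)
    show ?thesis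
    proof (cases "p mod m = 0")
      case True
      then show ?thesis
        using eq by (metis hom_poly_0 inverse_zero)
    next
      case False
      then have "degree (p mod m) < degree m"
        using degree_mod_less[of m p] m by auto
      then show ?thesis
        using hom_poly_inverse[OF m min False] eq by metis
    qed
  qed
  show ?thesis
    unfolding is_subfield_def
  proof (intro conjI ballI)
    show "0 \<in> range (hom_poly y)" "1 \<in> range (hom_poly y)"
      by (metis hom_poly_0 rangeI, metis hom_poly_1 rangeI)
    fix a assume "a \<in> range (hom_poly y)"
    then obtain p where p: "a = hom_poly y p"
      by blast
    then show "inverse a \<in> range (hom_poly y)"
      using inv[of p] by auto
    fix b assume "b \<in> range (hom_poly y)"
    then obtain r where r: "b = hom_poly y r"
      by blast
    show "a + b \<in> range (hom_poly y)"
      unfolding p r by (metis hom_poly_add rangeI)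
    show "a - b \<in> range (hom_poly y)"
      unfolding p r by (metis hom_poly_diff rangeI)
    show "a * b \<in> range (hom_poly y)"
      unfolding p r by (metis hom_poly_mult rangeI)
  qed
qed

end


section \<open>Valuation rings\<close>

definition subring :: "'a::field set \<Rightarrow> bool" where
  "subring S \<longleftrightarrow> 0 \<in> S \<and> 1 \<in> S \<and> (\<forall>a\<in>S. \<forall>b\<in>S. a + b \<in> S \<and> a - b \<in> S \<and> a * b \<in> S)"

lemma subringD:
  assumes "subring S"
  shows "0 \<in> S" "1 \<in> S" "\<And>a b. a \<in> S \<Longrightarrow> b \<in> S \<Longrightarrow> a + b \<in> S"
    "\<And>a b. a \<in> S \<Longrightarrow> b \<in> S \<Longrightarrow> a - b \<in> S" "\<And>a b. a \<in> S \<Longrightarrow> b \<in> S \<Longrightarrow> a * b \<in> S"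
  using assms by (auto simp: subring_def)

lemma subring_uminus: "subring S \<Longrightarrow> a \<in> S \<Longrightarrow> - a \<in> S"
  using subringD(4)[of S 0 a] subringD(1)[of S] by simp

lemma subring_power: "subring S \<Longrightarrow> a \<in> S \<Longrightarrow> a ^ k \<in> S"
  by (induction k) (simp_all add: subringD)

lemma subring_sum: "subring S \<Longrightarrow> (\<And>i. i \<in> A \<Longrightarrow> f i \<in> S) \<Longrightarrow> sum f A \<in> S"
  by (induction A rule: infinite_finite_induct) (simp_all add: subringD)

definition adjoin :: "'a::field set \<Rightarrow> 'a \<Rightarrow> 'a set" where
  "adjoin S z = {poly p z | p. \<forall>i. coeff p i \<in> S}"

lemma subring_adjoin:
  assumes "subring S"
  shows "subring (adjoin S z)"
  unfolding subring_def
proof (intro conjI ballI)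
  note S = subringD[OF assms]
  show "0 \<in> adjoin S z"
    unfolding adjoin_def using S by (intro CollectI exI[of _ 0]) simp
  show "1 \<in> adjoin S z"
    unfolding adjoin_def using S by (intro CollectI exI[of _ 1]) (simp add: coeff_1)
  fix a b assume "a \<in> adjoin S z" "b \<in> adjoin S z"
  then obtain p r where p: "a = poly p z" "b = poly r z" "\<And>i. coeff p i \<in> S" "\<And>i. coeff r i \<in> S"
    unfolding adjoin_def by blast
  show "a + b \<in> adjoin S z"
    unfolding adjoin_def using S p by (intro CollectI exI[of _ "p + r"]) simp
  show "a - b \<in> adjoin S z"
    unfolding adjoin_def using S p by (intro CollectI exI[of _ "p - r"]) simp
  show "a * b \<in> adjoin S z"
    unfolding adjoin_def using S p assms
    by (intro CollectI exI[of _ "p * r"]) (auto simp: coeff_mult intro!: subring_sum)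
qed

lemma adjoin_superset:
  assumes "subring S"
  shows "S \<subseteq> adjoin S z"
proof
  fix a assume "a \<in> S"
  then show "a \<in> adjoin S z"
    unfolding adjoin_def using subringD[OF assms]
    by (intro CollectI exI[of _ "[:a:]"]) (auto simp: coeff_pCons split: nat.split)
qed

lemma adjoin_self:
  assumes "subring S"
  shows "z \<in> adjoin S z"
  unfolding adjoin_def using subringD[OF assms]
  by (intro CollectI exI[of _ "[:0, 1:]"]) (auto simp: coeff_pCons split: nat.split)

lemma power_mult_inverse_power:
  "(z :: 'a::field) \<noteq> 0 \<Longrightarrow> z ^ i * inverse z ^ i = 1"
  by (simp add: power_inverse)

lemma inverse_power_mult_power:
  fixes z :: "'a::field"
  assumes "z \<noteq> 0" "i \<le> d"
  shows "inverse z ^ i * z ^ d = z ^ (d - i)"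
  using assms by (simp add: power_diff power_inverse divide_inverse mult.commute)

text \<open>The shortening step of Chevalley's argument. Moving \<open>b 0\<close> to the left turns
  the expression in \<open>inverse z\<close> into one for \<open>x * u\<close> with
  \<open>inverse u \<in> M\<close>, so after division its constant term is gone. Multiplied by
  \<open>z ^ Suc d\<close>, it involves only powers of \<open>z\<close> up to \<open>d\<close>, and
  so eliminates the top term of the expression in \<open>z\<close>.\<close>

lemma maximal_subring_lower_degree:
  fixes M :: "'a::field set"
  assumes M: "subring M" and z0: "z \<noteq> 0" and x0: "x \<noteq> 0"
    and unit: "\<And>s. s \<in> M \<Longrightarrow> inverse (1 - inverse x * s) \<in> M" "\<And>s. s \<in> M \<Longrightarrow> 1 - inverse x * s \<noteq> 0"
    and xM: "inverse x \<in> M"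
    and a: "\<And>i. a i \<in> M" "x = (\<Sum>i\<le>Suc d. a i * z ^ i)"
    and b: "\<And>i. b i \<in> M" "x = (\<Sum>i\<le>e. b i * inverse z ^ i)"
    and e: "e \<le> Suc d"
  shows "\<exists>a'. (\<forall>i. a' i \<in> M) \<and> x = (\<Sum>i\<le>d. a' i * z ^ i)"
proof -
  note S = subringD[OF M]
  define u where "u = 1 - inverse x * b 0"
  have u: "u \<noteq> 0" "inverse u \<in> M"
    using unit b(1) by (simp_all add: u_def)
  define c where "c j = (if j \<le> e then b j * inverse u else 0)" for j
  have c: "c j \<in> M" for j
    using b(1) u S by (simp add: c_def)
  have "x * u = x - b 0"
    using x0 by (simp add: u_def algebra_simps)
  also have "\<dots> = (\<Sum>j\<in>{1..e}. b j * inverse z ^ j)"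
    using b(2) by (simp add: sum.atMost_shift atMost_atLeast0 sum.atLeast_Suc_atMost)
  finally have "x = (\<Sum>j\<in>{1..e}. b j * inverse z ^ j) * inverse u"
    using u by (simp add: field_simps)
  also have "\<dots> = (\<Sum>j\<in>{1..e}. c j * inverse z ^ j)"
    unfolding sum_distrib_right by (intro sum.cong) (auto simp: c_def)
  also have "\<dots> = (\<Sum>j\<in>{1..Suc d}. c j * inverse z ^ j)"
    using e by (intro sum.mono_neutral_left) (auto simp: c_def)
  finally have x1: "x = (\<Sum>j\<in>{1..Suc d}. c j * inverse z ^ j)" .
  have "z ^ Suc d = inverse x * (x * z ^ Suc d)"
    using x0 by simp
  also have "x * z ^ Suc d = (\<Sum>j\<in>{1..Suc d}. c j * z ^ (Suc d - j))"
    by (subst x1, unfold sum_distrib_right, rule sum.cong)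
      (simp_all only: atLeastAtMost_iff mult.assoc inverse_power_mult_power[OF z0])
  also have "\<dots> = (\<Sum>i\<le>d. c (Suc d - i) * z ^ i)"
    by (rule sum.reindex_bij_witness[of _ "\<lambda>i. Suc d - i" "\<lambda>j. Suc d - j"]) auto
  finally have z1: "z ^ Suc d = inverse x * (\<Sum>i\<le>d. c (Suc d - i) * z ^ i)" .
  define a' where "a' i = a i + a (Suc d) * inverse x * c (Suc d - i)" for i
  have "x = (\<Sum>i\<le>d. a i * z ^ i) + a (Suc d) * z ^ Suc d"
    using a(2) by simp
  also have "\<dots> = (\<Sum>i\<le>d. a' i * z ^ i)"
    by (simp only: z1) (simp add: a'_def sum.distrib sum_distrib_left algebra_simps)
  finally show ?thesis
    using a(1) c xM S by (intro exI[of _ a']) (auto simp: a'_def)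
qed

text \<open>Chevalley's extension theorem, in the case of the ideal generated by \<open>inverse x\<close>.\<close>

lemma valuation_ring_avoiding:
  fixes x :: "'a::field"
  assumes S0: "subring S0" and xS: "inverse x \<in> S0" "x \<notin> S0"
  obtains R where "subring R" "S0 \<subseteq> R" "x \<notin> R" "\<And>z. z \<notin> R \<Longrightarrow> inverse z \<in> R"
proof -
  have x0: "x \<noteq> 0"
    using subringD(1)[OF S0] xS by auto
  define \<A> where "\<A> = {S. subring S \<and> S0 \<subseteq> S \<and> x \<notin> S}"
  have "\<exists>M\<in>\<A>. \<forall>S\<in>\<A>. M \<subseteq> S \<longrightarrow> S = M"
  proof (rule subset_Zorn_nonempty)
    show "\<A> \<noteq> {}"
      using S0 xS by (auto simp: \<A>_def)
    fix C assume C: "C \<noteq> {}" "subset.chain \<A> C"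
    then have CA: "\<And>S. S \<in> C \<Longrightarrow> subring S \<and> S0 \<subseteq> S \<and> x \<notin> S"
      by (auto simp: subset_chain_def \<A>_def)
    have pair: "\<exists>S\<in>C. a \<in> S \<and> b \<in> S" if "a \<in> \<Union>C" "b \<in> \<Union>C" for a b
      using that C(2) unfolding subset_chain_def by blast
    have "subring (\<Union>C)"
      unfolding subring_def
    proof (intro conjI ballI)
      show "0 \<in> \<Union>C" "1 \<in> \<Union>C"
        using C(1) CA subringD(1,2) by blast+
      fix a b assume "a \<in> \<Union>C" "b \<in> \<Union>C"
      then obtain S where "S \<in> C" "a \<in> S" "b \<in> S"
        using pair by blast
      then show "a + b \<in> \<Union>C" "a - b \<in> \<Union>C" "a * b \<in> \<Union>C"
        using CA subringD(3,4,5) by blast+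
    qed
    then show "\<Union>C \<in> \<A>"
      using C(1) CA by (auto simp: \<A>_def)
  qed
  then obtain M where M\<A>: "M \<in> \<A>" and max\<A>: "\<forall>S\<in>\<A>. M \<subseteq> S \<longrightarrow> S = M" ..
  then have M: "subring M" "S0 \<subseteq> M" "x \<notin> M"
    by (auto simp: \<A>_def)
  have max: "S = M" if "subring S" "M \<subseteq> S" "x \<notin> S" for S
    using max\<A> that M(2) by (auto simp: \<A>_def)
  note S = subringD[OF M(1)]
  have xM: "inverse x \<in> M"
    using M(2) xS by blast
  have adj: "\<exists>p. x = poly p z \<and> (\<forall>i. coeff p i \<in> M)" if "z \<notin> M" for z
  proof -
    have "x \<in> adjoin M z"
      using max[OF subring_adjoin[OF M(1)] adjoin_superset[OF M(1)], of z] adjoin_self[OF M(1), of z] that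
      by metis
    then show ?thesis
      unfolding adjoin_def by blast
  qed
  have nz: "1 - inverse x * s \<noteq> 0" if "s \<in> M" for s
    using that M(3) x0 by (auto simp: field_simps)
  \<comment> \<open>If the inverse of \<open>?v\<close> were missing, \<open>x\<close> would be a
    polynomial in it over \<open>M\<close>. Multiplication by \<open>?v ^ ?d\<close> clears the
    inverses, and as \<open>?v ^ ?d\<close> is still of the form \<open>1 - inverse x * r\<close>,
    the product is \<open>x - r\<close>. This would force \<open>x\<close> into
    \<open>M\<close>.\<close>
  have unit: "inverse (1 - inverse x * s) \<in> M" if s: "s \<in> M" for s
  proof (rule ccontr)
    let ?v = "1 - inverse x * s"
    assume "inverse ?v \<notin> M"
    from adj[OF this] obtain p where p: "x = poly p (inverse ?v)" "\<And>i. coeff p i \<in> M"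
      by blast
    have pow: "\<exists>r\<in>M. ?v ^ k = 1 - inverse x * r" for k
    proof (induction k)
      case 0
      show ?case using S by (intro bexI[of _ 0]) auto
    next
      case (Suc k)
      then obtain r where r: "r \<in> M" "?v ^ k = 1 - inverse x * r" by blast
      have "?v ^ Suc k = 1 - inverse x * (r + s - s * inverse x * r)"
        by (simp only: power_Suc r(2)) (simp add: algebra_simps)
      then show ?case
        using r s S xM by (intro bexI[of _ "r + s - s * inverse x * r"]) auto
    qed
    let ?d = "degree p"
    have "x * ?v ^ ?d = (\<Sum>i\<le>?d. coeff p i * ?v ^ (?d - i))"
      by (subst p(1), unfold poly_altdef sum_distrib_right, rule sum.cong)
        (simp_all only: atMost_iff mult.assoc inverse_power_mult_power[OF nz[OF s]])
    also have "\<dots> \<in> M"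
      by (intro subring_sum[OF M(1)] S(2,4,5) subring_power[OF M(1)] p(2) s xM)
    finally have *: "x * ?v ^ ?d \<in> M" .
    obtain r where r: "r \<in> M" "?v ^ ?d = 1 - inverse x * r"
      using pow by blast
    have "x * ?v ^ ?d + r = x"
      unfolding r(2) using x0 by (simp add: algebra_simps)
    then have "x \<in> M"
      using S(3)[OF * r(1)] by (simp only:)
    then show False
      using M(3) by simp
  qed
  have "inverse z \<in> M" if "z \<notin> M" for z
  proof (rule ccontr)
    assume iz: "inverse z \<notin> M"
    define Q where "Q d z \<longleftrightarrow> (\<exists>a. (\<forall>i. a i \<in> M) \<and> x = (\<Sum>i\<le>d. a i * z ^ i))" for d z
    have ex: "\<exists>d. Q d w" if "w \<notin> M" for w
      using adj[OF that] unfolding Q_def poly_altdef by blast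
    have Q0: "\<not> Q 0 w" for w
      using M(3) by (auto simp: Q_def)
    have step: "Q d w" if Qs: "Q (Suc d) w" "Q e (inverse w)" "e \<le> Suc d" "w \<noteq> 0" for d e w
    proof -
      obtain a where a: "(\<forall>i. a i \<in> M) \<and> x = (\<Sum>i\<le>Suc d. a i * w ^ i)"
        using Qs(1) unfolding Q_def ..
      obtain b where b: "(\<forall>i. b i \<in> M) \<and> x = (\<Sum>i\<le>e. b i * inverse w ^ i)"
        using Qs(2) unfolding Q_def ..
      show ?thesis
        unfolding Q_def
        by (rule maximal_subring_lower_degree[OF M(1) Qs(4) x0 unit nz xM
              spec[OF conjunct1[OF a]] conjunct2[OF a] spec[OF conjunct1[OF b]] conjunct2[OF b] Qs(3)])
    qed
    have z0: "z \<noteq> 0"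
      using that S by auto
    \<comment> \<open>The shortest expressions of \<open>x\<close> in powers of \<open>z\<close> and
      of \<open>inverse z\<close>: whichever is at least as long as the other could still be
      shortened.\<close>
    define d e where "d = (LEAST d. Q d z)" and "e = (LEAST d. Q d (inverse z))"
    have d: "Q d z" "\<And>k. k < d \<Longrightarrow> \<not> Q k z"
      using ex[OF that] not_less_Least unfolding d_def by (auto intro: LeastI_ex)
    have e: "Q e (inverse z)" "\<And>k. k < e \<Longrightarrow> \<not> Q k (inverse z)"
      using ex[OF iz] not_less_Least unfolding e_def by (auto intro: LeastI_ex)
    obtain d' where d': "d = Suc d'"
      using d(1) Q0 by (cases d) auto
    obtain e' where e': "e = Suc e'"
      using e(1) Q0 by (cases e) auto
    show False
    proof (cases "e \<le> d")
      case True
      then show False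
        using step[of d' z e] d e z0 d' by auto
    next
      case False
      then show False
        using step[of e' "inverse z" d] d e z0 e' by auto
    qed
  qed
  then show thesis
    using M that by blast
qed

text \<open>Constants and properness are carried separately: the former as
  \<open>KE emb \<subseteq> R\<close>, the latter through \<open>X \<notin> R\<close> or through the
  nonzero element \<open>X - const a\<close> of the maximal ideal.\<close>

locale vring =
  fixes R :: "'a::field set"
  assumes subring: "subring R" and inverse_in: "z \<notin> R \<Longrightarrow> inverse z \<in> R"
begin

lemmas closed = subringD[OF subring] subring_uminus[OF subring] subring_power[OF subring]
  subring_sum[OF subring]

definition max_ideal :: "'a set" where
  "max_ideal = {z \<in> R. z = 0 \<or> inverse z \<notin> R}"

definition unit :: "'a \<Rightarrow> bool" where
  "unit u \<longleftrightarrow> u \<noteq> 0 \<and> u \<in> R \<and> inverse u \<in> R"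

lemma unit_or_max_ideal: "z \<in> R \<Longrightarrow> unit z \<longleftrightarrow> z \<notin> max_ideal"
  by (auto simp: unit_def max_ideal_def)

lemma unit_1: "unit 1"
  by (simp add: unit_def closed)

lemma unit_mult: "unit u \<Longrightarrow> unit v \<Longrightarrow> unit (u * v)"
  by (simp add: unit_def closed)

lemma unit_inverse: "unit u \<Longrightarrow> unit (inverse u)"
  by (simp add: unit_def)

lemma unit_power: "unit u \<Longrightarrow> unit (u ^ k)"
  by (induction k) (simp_all add: unit_1 unit_mult)

lemma unit_mult_in_iff: "unit u \<Longrightarrow> u * z \<in> R \<longleftrightarrow> z \<in> R"
proof -
  assume u: "unit u"
  then have "inverse u * (u * z) = z"
    by (simp add: unit_def)
  then show ?thesis
    using u closed(5)[of "inverse u" "u * z"] closed(5)[of u z] by (metis unit_def)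
qed

lemma power_in_iff:
  assumes "k > 0"
  shows "z ^ k \<in> R \<longleftrightarrow> z \<in> R"
proof
  assume zk: "z ^ k \<in> R"
  show "z \<in> R"
  proof (rule ccontr)
    assume z: "z \<notin> R"
    then have "inverse z ^ (k - 1) \<in> R"
      by (intro closed inverse_in)
    then have "z ^ k * inverse z ^ (k - 1) \<in> R"
      using zk closed by blast
    moreover have "z \<noteq> 0"
      using z closed by auto
    then have "z ^ k * inverse z ^ (k - 1) = z"
      using assms by (cases k) (simp_all add: power_inverse)
    ultimately show False
      using z by simp
  qed
qed (simp add: closed)

lemma max_ideal_mult:
  assumes "a \<in> R" "z \<in> max_ideal"
  shows "a * z \<in> max_ideal"
proof (cases "a * z = 0")
  case False
  have "inverse (a * z) \<notin> R"
  proof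
    assume "inverse (a * z) \<in> R"
    then have "a * inverse (a * z) \<in> R"
      using assms closed by blast
    moreover have "a * inverse (a * z) = inverse z"
      using False by (simp add: inverse_mult_distrib flip: mult.assoc)
    ultimately have "inverse z \<in> R"
      by metis
    then show False
      using assms False by (auto simp: max_ideal_def)
  qed
  then show ?thesis
    using assms closed by (auto simp: max_ideal_def)
next
  case True
  show ?thesis
    unfolding True by (simp add: max_ideal_def closed(1))
qed

lemma max_ideal_0: "0 \<in> max_ideal"
  by (simp add: max_ideal_def closed)

lemma max_ideal_subset: "z \<in> max_ideal \<Longrightarrow> z \<in> R"
  by (simp add: max_ideal_def)

lemma max_ideal_add:
  assumes "z \<in> max_ideal" "w \<in> max_ideal"
  shows "z + w \<in> max_ideal"
proof (cases "z = 0 \<or> w = 0")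
  case False
  \<comment> \<open>One of \<open>w / z\<close> and \<open>z / w\<close> lies in \<open>R\<close>,
    so one of the two factorisations has its cofactor in \<open>R\<close>.\<close>
  have "z + w = z * (1 + w * inverse z)" "z + w = w * (1 + inverse (w * inverse z))"
    using False by (simp_all add: field_simps)
  moreover have "1 + w * inverse z \<in> R \<or> 1 + inverse (w * inverse z) \<in> R"
    using inverse_in closed by metis
  ultimately show ?thesis
    using max_ideal_mult assms by (metis mult.commute)
qed (use assms in auto)

lemma max_ideal_sum: "(\<And>i. i \<in> A \<Longrightarrow> f i \<in> max_ideal) \<Longrightarrow> sum f A \<in> max_ideal"
  by (induction A rule: infinite_finite_induct) (auto simp: max_ideal_0 max_ideal_add)

lemma max_ideal_uminus: "z \<in> max_ideal \<Longrightarrow> - z \<in> max_ideal"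
  using max_ideal_mult[of "-1" z] by (simp add: closed)

lemma max_ideal_diff: "z \<in> max_ideal \<Longrightarrow> w \<in> max_ideal \<Longrightarrow> z - w \<in> max_ideal"
  using max_ideal_add[of z "- w"] max_ideal_uminus by simp

lemma unit_add_max_ideal:
  assumes "unit u" "z \<in> max_ideal"
  shows "unit (u + z)"
proof -
  have "u + z \<notin> max_ideal"
  proof
    assume "u + z \<in> max_ideal"
    then have "u + z - z \<in> max_ideal"
      using assms max_ideal_diff by blast
    then show False
      using assms unit_or_max_ideal unit_def by auto
  qed
  then show ?thesis
    using assms unit_or_max_ideal max_ideal_subset closed unit_def by auto
qed

lemma inverse_in_max_ideal: "z \<notin> R \<Longrightarrow> inverse z \<in> max_ideal"
  using inverse_in by (simp add: max_ideal_def)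

lemma in_iff_max_ideal: "z \<in> R \<longleftrightarrow> z = 0 \<or> inverse z \<notin> max_ideal"
  using inverse_in_max_ideal[of z] closed by (auto simp: max_ideal_def)

lemma val_ring_max_ideal: "val_ring max_ideal = R"
  unfolding val_ring_def using in_iff_max_ideal by auto

end


section \<open>Trace and second symmetric polynomial in characteristic \<open>p\<close>\<close>

lemma of_nat_card_UNIV_eq_0: "of_nat (card (UNIV :: 'a set)) = (0 :: 'a::{field,finite})"
proof -
  have "(\<Sum>x\<in>(UNIV :: 'a set). x + 1) = (\<Sum>x\<in>(UNIV :: 'a set). x)"
    by (rule sum.reindex_bij_witness[of _ "\<lambda>x. x - 1" "\<lambda>x. x + 1"]) auto
  then show ?thesis
    by (simp add: sum.distrib)
qed

lemma power_card_UNIV: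
  fixes x :: "'a::{field,finite}"
  shows "x ^ card (UNIV :: 'a set) = x"
proof (cases "x = 0")
  case False
  let ?U = "UNIV - {0 :: 'a}"
  have "prod id ?U = (\<Prod>y\<in>?U. x * y)"
    by (rule prod.reindex_bij_witness[of _ "\<lambda>y. x * y" "\<lambda>y. y / x"]) (use False in auto)
  also have "\<dots> = x ^ card ?U * prod id ?U"
    by (simp add: prod.distrib)
  finally have "x ^ card ?U = 1"
    by simp
  then have "x ^ Suc (card ?U) = x"
    by simp
  then show ?thesis
    by (subst (asm) card_Suc_Diff1) auto
next
  case True
  then show ?thesis
    by (simp add: power_0_left)
qed

lemma CHAR_of_card_prime_power:
  assumes "prime p" "card (UNIV :: 'a::{field,finite} set) = p ^ k"
  shows "CHAR('a) = p"
proof -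
  have "of_nat (p ^ k) = (0 :: 'a)"
    using of_nat_card_UNIV_eq_0[where 'a = 'a] assms(2) by simp
  then have "of_nat p = (0 :: 'a)"
    by simp
  then have "CHAR('a) dvd p"
    by (simp add: of_nat_eq_0_iff_char_dvd)
  then show ?thesis
    using assms(1) by (auto simp: prime_nat_iff)
qed

text \<open>Stands for \<open>q\<close> being a power of the characteristic. Isolating the
  additivity lets the same identities serve the finite field \<open>K\<close> and the function field
  \<open>E\<close>.\<close>

locale additive_power =
  fixes q :: nat and type :: "'a::field itself"
  assumes q_pos: "q > 0"
    and add_power: "(a + b) ^ q = a ^ q + (b :: 'a) ^ q"
begin

lemma add_pow: "(a + b) ^ (q ^ i) = a ^ (q ^ i) + (b :: 'a) ^ (q ^ i)"
  by (induction i) (simp_all add: power_mult add_power mult.commute[of q])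

lemma uminus_pow: "(- a) ^ (q ^ i) = - ((a :: 'a) ^ (q ^ i))"
  using add_pow[of a "- a" i] q_pos by (simp add: power_0_left eq_neg_iff_add_eq_0 add.commute)

lemma diff_pow: "(a - b) ^ (q ^ i) = a ^ (q ^ i) - (b :: 'a) ^ (q ^ i)"
  using add_pow[of a "- b" i] by (simp add: uminus_pow)

lemma sum_pow: "(sum f A) ^ (q ^ i) = (\<Sum>a\<in>A. (f a :: 'a) ^ (q ^ i))"
  using q_pos by (induction A rule: infinite_finite_induct) (simp_all add: add_pow power_0_left)

lemma diff_power: "(a - b) ^ q = a ^ q - (b :: 'a) ^ q"
  using diff_pow[of a b 1] by simp

lemma sum_power: "(sum f A) ^ q = (\<Sum>a\<in>A. (f a :: 'a) ^ q)"
  using sum_pow[of f A 1] by simp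

lemma addtr_add: "addtr q n (a + b) = addtr q n a + addtr q n (b :: 'a)"
  by (simp add: addtr_def add_pow sum.distrib)

lemma addtr_uminus: "addtr q n (- a) = - addtr q n (a :: 'a)"
  by (simp add: addtr_def uminus_pow sum_negf)

lemma addtr_diff: "addtr q n (a - b) = addtr q n a - addtr q n (b :: 'a)"
  by (simp add: addtr_def diff_pow sum_subtractf)

lemma s_n2_0: "s_n2 q n (0 :: 'a) = 0"
  using q_pos by (simp add: s_n2_def power_0_left)

text \<open>Since \<open>t ^ (q ^ n) = t\<close>, raising to the power \<open>q\<close> permutes the
  \<open>n\<close> conjugates of \<open>t\<close> cyclically.\<close>

lemma sum_pow_shift:
  assumes "(t :: 'a) ^ (q ^ n) = t"
  shows "(\<Sum>i<n. t ^ (q ^ (i + j))) = addtr q n t"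
proof (induction j)
  case (Suc j)
  have "t ^ (q ^ (n + j)) = t ^ (q ^ j)"
    by (simp add: power_add power_mult assms)
  moreover have "(\<Sum>i<n. t ^ (q ^ (i + Suc j))) + t ^ (q ^ j) = (\<Sum>i<n. t ^ (q ^ (i + j))) + t ^ (q ^ (n + j))"
    using sum.lessThan_Suc_shift[of "\<lambda>i. t ^ (q ^ (i + j))" n]
    by (simp add: add.commute)
  ultimately show ?case
    using Suc by simp
qed (simp add: addtr_def)

text \<open>The origin of the coefficient of \<open>x\<close> in \<open>\<sigma> y\<close>. The
  mixed terms of the second elementary symmetric polynomial of a sum are the product of the two
  power sums minus the diagonal products. As \<open>t\<close> has only the conjugates listed, the
  power \<open>q ^ j\<close> of \<open>\<Sum>i\<in>{1..<n}. t ^ (q ^ i)\<close> is the trace of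
  \<open>t\<close> without the \<open>j\<close>-th conjugate, so the mixed terms form a single value
  of \<open>addtr\<close>.\<close>

lemma s_n2_add:
  fixes x t :: 'a
  assumes "n > 0" "t ^ (q ^ n) = t"
  shows "s_n2 q n (x + t) = s_n2 q n x + s_n2 q n t + addtr q n (x * (\<Sum>i\<in>{1..<n}. t ^ (q ^ i)))"
proof -
  let ?f = "\<lambda>i. x ^ (q ^ i)" and ?g = "\<lambda>i. t ^ (q ^ i)"
  have prod: "(\<Sum>k<m. f k) * (\<Sum>k<m. g k) = (\<Sum>k<m. \<Sum>j<k. f j * g k + g j * f k) + (\<Sum>k<m. f k * g k)"
    for f g :: "nat \<Rightarrow> 'a" and m
    by (induction m) (simp_all add: algebra_simps sum.distrib sum_distrib_left)
  have inner: "(\<Sum>i\<in>{1..<n}. t ^ (q ^ i)) ^ (q ^ j) = addtr q n t - ?g j" for j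
  proof -
    have "(\<Sum>i\<in>{1..<n}. t ^ (q ^ i)) ^ (q ^ j) = (\<Sum>i\<in>{1..<n}. t ^ (q ^ (i + j)))"
      by (simp add: sum_pow power_add power_mult)
    moreover have "(\<Sum>i<n. t ^ (q ^ (i + j))) = ?g j + (\<Sum>i\<in>{1..<n}. t ^ (q ^ (i + j)))"
      using assms(1) by (simp add: lessThan_atLeast0 sum.atLeast_Suc_lessThan)
    ultimately show ?thesis
      using sum_pow_shift[OF assms(2), of j] by simp
  qed
  have "addtr q n (x * (\<Sum>i\<in>{1..<n}. t ^ (q ^ i))) = (\<Sum>j<n. ?f j * (addtr q n t - ?g j))"
    unfolding addtr_def[of q n "_ * _"] power_mult_distrib inner ..
  also have "\<dots> = (\<Sum>j<n. ?f j) * (\<Sum>j<n. ?g j) - (\<Sum>j<n. ?f j * ?g j)"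
    by (simp add: addtr_def algebra_simps sum_subtractf sum_distrib_left)
  also have "\<dots> = (\<Sum>k<n. \<Sum>j<k. ?f j * ?g k + ?g j * ?f k)"
    by (subst prod) simp
  finally show ?thesis
    by (simp add: s_n2_def power_add add_pow algebra_simps sum.distrib)
qed

text \<open>A symmetric function of the conjugates is unchanged by their cyclic permutation. Hence
  its values lie in the field with \<open>q\<close> elements, which is the image of the
  trace.\<close>

lemma s_n2_pow:
  fixes t :: 'a
  assumes "t ^ (q ^ n) = t"
  shows "s_n2 q n t ^ q = s_n2 q n t"
proof -
  let ?g = "\<lambda>i. t ^ (q ^ i)"
  have shift: "(\<Sum>k<Suc m. \<Sum>j<k. g j * g k) = (\<Sum>k<m. \<Sum>j<k. g (Suc j) * g (Suc k)) + g 0 * (\<Sum>j<m. g (Suc j))"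
    for g :: "nat \<Rightarrow> 'a" and m
    unfolding sum.lessThan_Suc_shift by (simp add: sum.distrib sum_distrib_left add.commute)
  have "s_n2 q n t ^ q = (\<Sum>k<n. \<Sum>j<k. ?g (Suc j) * ?g (Suc k))"
    by (simp add: s_n2_def sum_power power_add power_mult_distrib mult.commute[of q] flip: power_mult)
  \<comment> \<open>The pairs of indices from \<open>0\<close> to \<open>n\<close> are split in two
    ways, setting apart those that contain \<open>0\<close> or those that contain \<open>n\<close>.
    As \<open>?g n = ?g 0\<close>, the parts set apart have the same sum.\<close>
  also have "\<dots> = (\<Sum>k<Suc n. \<Sum>j<k. ?g j * ?g k) - ?g 0 * (\<Sum>j<n. ?g (Suc j))"
    by (simp only: shift) simp
  also have "(\<Sum>j<n. ?g (Suc j)) = (\<Sum>j<n. ?g j)"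
    using sum_pow_shift[OF assms, of 1] by (simp add: addtr_def)
  also have "(\<Sum>k<Suc n. \<Sum>j<k. ?g j * ?g k) = s_n2 q n t + (\<Sum>j<n. ?g j) * t"
    by (simp add: s_n2_def power_add assms sum_distrib_right)
  finally show ?thesis
    by (simp add: mult.commute)
qed

lemma addtr_pow:
  assumes "(t :: 'a) ^ (q ^ n) = t"
  shows "addtr q n t ^ q = addtr q n t"
  using sum_power[of "\<lambda>i. t ^ (q ^ i)" "{..<n}"] sum_pow_shift[OF assms, of 1]
  by (simp add: addtr_def power_add power_mult mult.commute[of q])

end

lemma card_power_fixed_le:
  assumes "q > 1"
  shows "card {c :: 'a::field. c ^ q = c} \<le> q"
proof -
  let ?p = "monom 1 q - [:0, 1:] :: 'a poly"
  have "coeff ?p q = 1"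
    using assms by (simp add: coeff_pCons split: nat.split)
  then have "?p \<noteq> 0" by force
  have "degree ?p \<le> q"
    using assms by (intro degree_diff_le) (auto simp: degree_monom_le)
  have "{c :: 'a. c ^ q = c} = {c. poly ?p c = 0}"
    by (simp add: poly_monom)
  then show ?thesis
    using card_poly_roots_bound[OF \<open>?p \<noteq> 0\<close>] \<open>degree ?p \<le> q\<close> by simp
qed

text \<open>Over \<open>K\<close> its roots form a fibre of the trace; over \<open>K(x)\<close> with
  \<open>c = s_n2 q n varF\<close> it is the defining polynomial of \<open>y\<close>.\<close>

definition addtr_poly :: "nat \<Rightarrow> nat \<Rightarrow> 'a::comm_ring_1 \<Rightarrow> 'a poly" where
  "addtr_poly q n c = (\<Sum>i<n. monom 1 (q ^ i)) - [:c:]"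

lemma addtr_poly:
  fixes c :: "'a::field"
  assumes "q > 1" "n > 0"
  shows "degree (addtr_poly q n c) = q ^ (n - 1)" "addtr_poly q n c \<noteq> 0"
    "poly (addtr_poly q n c) z = addtr q n z - c"
proof -
  have le: "degree (\<Sum>i<n. monom (1 :: 'a) (q ^ i)) \<le> q ^ (n - 1)"
    using assms by (intro degree_sum_le) (auto simp: degree_monom_eq intro!: power_increasing)
  have "coeff (\<Sum>i<n. monom (1 :: 'a) (q ^ i)) (q ^ (n - 1)) = (\<Sum>i<n. if i = n - 1 then 1 else 0)"
    using assms by (auto simp: coeff_sum intro!: sum.cong)
  then have "coeff (addtr_poly q n c) (q ^ (n - 1)) = 1"
    using assms by (simp add: addtr_poly_def coeff_pCons split: nat.split)
  moreover have "degree (addtr_poly q n c) \<le> q ^ (n - 1)"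
    unfolding addtr_poly_def using le by (intro degree_diff_le) auto
  ultimately show "degree (addtr_poly q n c) = q ^ (n - 1)" "addtr_poly q n c \<noteq> 0"
    by (metis le_antisym le_degree zero_neq_one, metis coeff_0 zero_neq_one)
  show "poly (addtr_poly q n c) z = addtr q n z - c"
    by (simp add: addtr_poly_def addtr_def poly_sum poly_monom)
qed

text \<open>A tight count: the trace has at most \<open>q\<close> values, each fibre has at most
  \<open>q ^ (n - 1)\<close> elements as a set of roots, and the fibres exhaust \<open>q ^ n\<close>
  elements. Hence both bounds are attained, and every \<open>c\<close> with \<open>c ^ q = c\<close>
  is a trace.\<close>

lemma card_addtr_fibre:
  fixes c :: "'k::{field,finite}"
  assumes F: "additive_power TYPE('k) q" and q: "q > 1" and n: "n > 0"
    and K: "card (UNIV :: 'k set) = q ^ n" and c: "c ^ q = c"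
  shows "card {d. addtr q n d = c} = q ^ (n - 1)"
proof -
  interpret additive_power q "TYPE('k)" by fact
  let ?T = "addtr q n :: 'k \<Rightarrow> 'k"
  have fix_all: "t ^ (q ^ n) = t" for t :: 'k
    using power_card_UNIV[of t] by (simp add: K)
  have fibre: "card {d. ?T d = c} \<le> q ^ (n - 1)" for c
    using card_poly_roots_bound[of "addtr_poly q n c"] addtr_poly[OF q n, of c] by simp
  have sub: "range ?T \<subseteq> {c. c ^ q = c}"
    using addtr_pow[OF fix_all] by auto
  have total: "(\<Sum>c\<in>range ?T. card {d. ?T d = c}) = q ^ n"
  proof -
    have "(\<Sum>c\<in>range ?T. card {d. ?T d = c}) = card (\<Union>c\<in>range ?T. {d. ?T d = c})"
      by (subst card_UN_disjoint) auto
    also have "(\<Union>c\<in>range ?T. {d. ?T d = c}) = UNIV"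
      by auto
    finally show ?thesis
      using K by simp
  qed
  have qn: "q ^ n = q * q ^ (n - 1)"
    using n by (cases n) auto
  have "q ^ n \<le> card (range ?T) * q ^ (n - 1)"
    using sum_mono[of "range ?T" "\<lambda>c. card {d. ?T d = c}" "\<lambda>_. q ^ (n - 1)"] fibre total by simp
  then have "q \<le> card (range ?T)"
    using q by (simp add: qn)
  then have eq: "range ?T = {c. c ^ q = c}" and card: "card (range ?T) = q"
    using card_seteq[OF _ sub] card_mono[OF _ sub] card_power_fixed_le[OF q, where 'a = 'k] by auto
  have "(\<Sum>c\<in>range ?T. card {d. ?T d = c}) = (\<Sum>c\<in>range ?T. q ^ (n - 1))"
    by (simp add: total card qn)
  then show ?thesis
    using sum_mono_inv[of "\<lambda>c. card {d. ?T d = c}" "range ?T" "\<lambda>_. q ^ (n - 1)" c] fibre c eq by simp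
qed

lemma card_addtr_eq_s_n2:
  assumes F: "additive_power TYPE('k::{field,finite}) q" and q: "q > 1" and n: "n > 0"
    and K: "card (UNIV :: 'k set) = q ^ n"
  shows "card {(t :: 'k, d). addtr q n d = s_n2 q n t} = q ^ (2 * n - 1)"
proof -
  interpret additive_power q "TYPE('k)" by fact
  have "{(t :: 'k, d). addtr q n d = s_n2 q n t} = Sigma UNIV (\<lambda>t. {d. addtr q n d = s_n2 q n t})"
    by auto
  then have "card {(t :: 'k, d). addtr q n d = s_n2 q n t} = (\<Sum>t\<in>(UNIV :: 'k set). q ^ (n - 1))"
    using card_addtr_fibre[OF F q n K s_n2_pow] power_card_UNIV[where 'a = 'k]
    by (simp add: K)
  also have "\<dots> = q ^ (n + (n - 1))"
    by (simp add: K power_add)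
  also have "n + (n - 1) = 2 * n - 1"
    using n by simp
  finally show ?thesis .
qed


section \<open>Orders with respect to a pole of \<open>x\<close>\<close>

text \<open>With \<open>x\<close> of order \<open>N\<close> (for \<open>N\<close> the degree of the extension), \<open>z\<close> has order \<open>k\<close> if
  \<open>z ^ N\<close> and \<open>x ^ k\<close> differ by a unit. The order is the negative of the normalised valuation,
  but it is at first a partial notion.\<close>

locale vring_pole = vring R for R :: "'a::field set" +
  fixes x :: 'a and N :: nat
  assumes x_notin: "x \<notin> R" and N_pos: "N > 0"
begin

lemma x_nonzero: "x \<noteq> 0"
  using x_notin closed by auto

definition ord :: "'a \<Rightarrow> int \<Rightarrow> bool" where
  "ord z k \<longleftrightarrow> unit (z ^ N * x powi (- k))"

lemma ord_nonzero: "ord z k \<Longrightarrow> z \<noteq> 0"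
  using N_pos by (auto simp: ord_def unit_def)

lemma ord_mult: "ord z k \<Longrightarrow> ord w l \<Longrightarrow> ord (z * w) (k + l)"
  using unit_mult[of "z ^ N * x powi (- k)" "w ^ N * x powi (- l)"] x_nonzero
  by (simp add: ord_def power_mult_distrib power_int_diff power_int_minus power_int_add field_simps)

lemma ord_inverse: "ord z k \<Longrightarrow> ord (inverse z) (- k)"
  using unit_inverse[of "z ^ N * x powi (- k)"]
  by (simp add: ord_def power_inverse power_int_minus)

lemma ord_unit: "unit u \<Longrightarrow> ord u 0"
  by (simp add: ord_def unit_power)

lemma ord_power: "ord z k \<Longrightarrow> ord (z ^ i) (int i * k)"
  by (induction i) (auto simp: ord_unit unit_1 algebra_simps dest: ord_mult)

lemma ord_x: "ord x (int N)"
  using x_nonzero by (simp add: ord_def unit_1 power_int_minus)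

lemma x_powi_in_iff: "x powi k \<in> R \<longleftrightarrow> k \<le> 0"
proof (cases "k \<le> 0")
  case True
  then have "x powi k = inverse x ^ nat (- k)"
    using x_nonzero by (simp add: power_int_def power_inverse)
  then show ?thesis
    using True closed inverse_in[OF x_notin] by simp
next
  case False
  then show ?thesis
    using x_notin power_in_iff[of "nat k" x] by (simp add: power_int_def)
qed

lemma ord_in_iff:
  assumes "ord z k"
  shows "z \<in> R \<longleftrightarrow> k \<le> 0"
proof -
  have "z ^ N = (z ^ N * x powi (- k)) * x powi k"
    using x_nonzero by (simp add: power_int_minus)
  then have "z ^ N \<in> R \<longleftrightarrow> x powi k \<in> R"
    using unit_mult_in_iff assms unfolding ord_def by metis
  then show ?thesis
    using power_in_iff[OF N_pos] x_powi_in_iff by simp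
qed

lemma ord_max_ideal_iff:
  assumes "ord z k"
  shows "z \<in> max_ideal \<longleftrightarrow> k < 0"
  using ord_in_iff[OF assms] ord_in_iff[OF ord_inverse[OF assms]] ord_nonzero[OF assms]
  by (auto simp: max_ideal_def)

lemma ord_add:
  assumes "ord z k" "ord w l" "k < l"
  shows "ord (z + w) l"
proof -
  have "ord (z * inverse w) (k + - l)"
    using assms ord_mult ord_inverse by blast
  then have "z * inverse w \<in> max_ideal"
    using ord_max_ideal_iff assms(3) by simp
  then have "unit (1 + z * inverse w)"
    using unit_add_max_ideal unit_1 by blast
  then have "ord (w * (1 + z * inverse w)) (l + 0)"
    using ord_mult ord_unit assms(2) by blast
  moreover have "w * (1 + z * inverse w) = z + w"
    using ord_nonzero[OF assms(2)] by (simp add: field_simps)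
  ultimately show ?thesis
    by simp
qed

text \<open>Distinct orders rule out cancellation, so the dominant term decides.\<close>

lemma ord_sum:
  assumes "finite I" "I \<noteq> {}" "\<And>i. i \<in> I \<Longrightarrow> ord (f i) (k i)" "inj_on k I"
  shows "ord (sum f I) (Max (k ` I))"
  using assms
proof (induction I rule: finite_ne_induct)
  case (insert i I)
  define M where "M = Max (k ` I)"
  have IH: "ord (sum f I) M"
    using insert by (simp add: inj_on_def M_def)
  have "M \<in> k ` I"
    unfolding M_def using insert by (intro Max_in) auto
  moreover have "k i \<notin> k ` I"
    using insert by (auto simp: inj_on_def)
  ultimately have "M \<noteq> k i"
    by metis
  moreover have "Max (k ` insert i I) = max (k i) M"
    using insert by (simp add: M_def)
  moreover have "sum f (insert i I) = f i + sum f I"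
    using insert by simp
  ultimately show ?case
    using ord_add[OF IH, of "f i" "k i"] ord_add[of "f i" "k i", OF _ IH] insert.prems
    by (auto simp: max_def add.commute)
qed simp

end


section \<open>The function field\<close>

lemma pcompose_linear_eq_0_iff: "p \<circ>\<^sub>p [:c, 1:] = 0 \<longleftrightarrow> p = (0 :: 'a::field poly)"
  using pcompose_eq_0[of p "[:c, 1:]"] by auto

text \<open>The prospective restriction of \<sigma> to \<open>K(x)\<close>.\<close>

lift_definition shiftF :: "'k::field \<Rightarrow> 'k poly fract \<Rightarrow> 'k poly fract" is
  "\<lambda>c u. (fst u \<circ>\<^sub>p [:c, 1:], snd u \<circ>\<^sub>p [:c, 1:])"
  by (simp add: pcompose_linear_eq_0_iff) (metis pcompose_mult)

lemma shiftF_Fract: "b \<noteq> 0 \<Longrightarrow> shiftF c (Fract a b) = Fract (a \<circ>\<^sub>p [:c, 1:]) (b \<circ>\<^sub>p [:c, 1:])"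
  by (simp add: Fract.abs_eq shiftF.abs_eq pcompose_linear_eq_0_iff)

lemma field_hom_shiftF: "field_hom (shiftF (c :: 'a::field))"
proof
  fix f g :: "'a poly fract"
  obtain a b where f: "f = Fract a b" "b \<noteq> 0"
    by (cases f) auto
  obtain a' b' where g: "g = Fract a' b'" "b' \<noteq> 0"
    by (cases g) auto
  show "shiftF c (f + g) = shiftF c f + shiftF c g"
    using f g by (simp add: pcompose_linear_eq_0_iff shiftF_Fract pcompose_add pcompose_mult)
  show "shiftF c (f * g) = shiftF c f * shiftF c g"
    using f g by (simp add: pcompose_linear_eq_0_iff shiftF_Fract pcompose_mult)
next
  show "shiftF c 1 = 1"
    by (simp add: One_fract_def shiftF_Fract pcompose_1)
qed

lemma shiftF_constF: "shiftF c (constF a) = constF a"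
  by (simp add: constF_def shiftF_Fract pcompose_1)

lemma shiftF_varF: "shiftF c varF = varF + constF c"
  by (simp add: constF_def varF_def shiftF_Fract pcompose_1 pcompose_pCons)

lemma field_hom_K_aut: "is_K_aut C \<sigma> \<Longrightarrow> field_hom \<sigma>"
  by (simp add: is_K_aut_def field_hom_def)

lemma is_K_aut_comp: "is_K_aut C \<sigma> \<Longrightarrow> is_K_aut C \<rho> \<Longrightarrow> is_K_aut C (\<sigma> \<circ> \<rho>)"
  by (simp add: is_K_aut_def bij_comp)

lemma is_K_aut_inv:
  assumes "is_K_aut C \<sigma>"
  shows "is_K_aut C (inv \<sigma>)"
proof -
  have b: "bij \<sigma>" and h: "\<And>a b. \<sigma> (a + b) = \<sigma> a + \<sigma> b" "\<And>a b. \<sigma> (a * b) = \<sigma> a * \<sigma> b" "\<sigma> 1 = 1"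
    and c: "\<And>c. c \<in> C \<Longrightarrow> \<sigma> c = c"
    using assms by (auto simp: is_K_aut_def)
  have [simp]: "\<sigma> (inv \<sigma> z) = z" for z
    using b by (simp add: bij_is_surj surj_f_inv_f)
  have eq: "inv \<sigma> z = w" if "\<sigma> w = z" for z w
    using that b by (simp add: bij_is_inj inv_f_eq)
  show ?thesis
    unfolding is_K_aut_def using b by (auto intro!: eq simp: h c bij_imp_bij_inv)
qed

locale tower =
  fixes q n :: nat
    and emb :: "'k::{field,finite} poly fract \<Rightarrow> 'e::field"
    and y :: 'e
  assumes q: "prime_power q"
    and n: "n \<ge> 2"
    and K: "card (UNIV :: 'k set) = q ^ n"
    and emb_add: "\<And>a b. emb (a + b) = emb a + emb b"
    and emb_mult: "\<And>a b. emb (a * b) = emb a * emb b"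
    and emb_one: "emb 1 = 1"
    and gen: "\<And>L. is_subfield L \<Longrightarrow> range emb \<subseteq> L \<Longrightarrow> y \<in> L \<Longrightarrow> L = UNIV"
    and eqn: "addtr q n y = emb (s_n2 q n varF)"
begin

sublocale emb: field_hom emb
  using emb_add emb_mult emb_one by unfold_locales

abbreviation X :: 'e where "X \<equiv> emb varF"
abbreviation const :: "'k \<Rightarrow> 'e" where "const c \<equiv> emb (constF c)"

sublocale constF: field_hom "constF :: 'k \<Rightarrow> 'k poly fract"
  by unfold_locales (simp_all add: constF_def One_fract_def one_pCons mult.commute)

sublocale const: field_hom const
  by unfold_locales (simp_all add: constF.hom_add constF.hom_mult constF.hom_one
      emb_add emb_mult emb_one)

lemma q_gt_1: "q > 1"
proof -
  obtain p m where "prime p" "m > 0" "q = p ^ m"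
    using q unfolding prime_power_def by blast
  then show ?thesis
    using prime_gt_1_nat[of p] by (simp add: one_less_power del: One_nat_def)
qed

lemma additive_power_E: "additive_power TYPE('e) q" and additive_power_K: "additive_power TYPE('k) q"
proof -
  obtain p m where p: "prime p" "m > 0" "q = p ^ m"
    using q unfolding prime_power_def by blast
  have K_char: "CHAR('k) = p"
    using CHAR_of_card_prime_power[OF p(1), of "m * n", where 'a = 'k] K p(3) by (simp add: power_mult)
  have "of_nat p = (0 :: 'e)"
    using const.hom_of_nat[of p] of_nat_CHAR[where 'a = 'k] by (simp add: K_char const.hom_zero)
  then have "CHAR('e) dvd p"
    by (simp add: of_nat_eq_0_iff_char_dvd)
  then have E_char: "CHAR('e) = p"
    using p(1) by (auto simp: prime_nat_iff)
  show "additive_power TYPE('e) q"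
  proof
    show "q > 0"
      using q_gt_1 by simp
    show "(a + b) ^ q = a ^ q + b ^ q" for a b :: 'e
      using freshmans_dream'[of q m a b] p E_char by simp
  qed
  show "additive_power TYPE('k) q"
  proof
    show "q > 0"
      using q_gt_1 by simp
    show "(a + b) ^ q = a ^ q + b ^ q" for a b :: 'k
      using freshmans_dream'[of q m a b] p K_char by simp
  qed
qed

sublocale E: additive_power q "TYPE('e)" by (rule additive_power_E)
sublocale K: additive_power q "TYPE('k)" by (rule additive_power_K)

lemma power_qn: "(t :: 'k) ^ (q ^ n) = t"
  using power_card_UNIV[of t] by (simp add: K)

abbreviation N :: nat where "N \<equiv> q ^ (n - 1)"

lemma fract_poly_pCons: "Fract (pCons a p) 1 = constF a + varF * Fract p 1"
  by (simp add: constF_def varF_def)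

text \<open>Lets inclusions of \<open>K(x)\<close> and equalities of homomorphisms on it be tested
  on the constants and \<open>varF\<close>.\<close>

lemma subfield_of_fract:
  assumes L: "is_subfield L" and c: "\<And>c. constF c \<in> L" and v: "varF \<in> L"
  shows "f \<in> (L :: 'k poly fract set)"
proof -
  have poly: "Fract p 1 \<in> L" for p :: "'k poly"
  proof (induction p)
    case 0
    show ?case
      using L by (simp add: is_subfield_def flip: Zero_fract_def)
  next
    case (pCons a p)
    then show ?case
      using L c v by (auto simp: is_subfield_def fract_poly_pCons)
  qed
  obtain a b where ab: "f = Fract a b" "b \<noteq> 0"
    by (cases f) auto
  then have "f = Fract a 1 * inverse (Fract b 1)"
    by simp
  then show ?thesis
    using L poly by (metis is_subfield_def)
qed

section \<open>Orders of rational functions at the poles of \<open>x\<close>\<close>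

definition pole_ring :: "'e set \<Rightarrow> bool" where
  "pole_ring R \<longleftrightarrow> vring R \<and> KE emb \<subseteq> R \<and> X \<notin> R"

lemma const_in_KE: "const c \<in> KE emb"
  by (auto simp: KE_def)

lemma vring_pole: "pole_ring R \<Longrightarrow> vring_pole R X N"
  using q_gt_1 by (simp add: pole_ring_def vring_pole_def vring_pole_axioms_def)

lemma unit_const:
  assumes "vring R" "KE emb \<subseteq> R" "c \<noteq> 0"
  shows "vring.unit R (const c)"
  using assms const_in_KE[of c] const_in_KE[of "inverse c"]
  by (auto simp: vring.unit_def const.hom_inverse const.hom_eq_0_iff)

abbreviation pole_ord :: "'e set \<Rightarrow> 'e \<Rightarrow> int \<Rightarrow> bool" where
  "pole_ord R \<equiv> vring_pole.ord R X N"

lemma ord_poly: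
  assumes R: "pole_ring R"
  shows "p \<noteq> 0 \<Longrightarrow> pole_ord R (emb (Fract p 1)) (int N * int (degree p))"
proof (induction p)
  case (pCons a p)
  interpret vring_pole R X N
    by (rule vring_pole[OF R])
  have eq: "emb (Fract (pCons a p) 1) = const a + X * emb (Fract p 1)"
    by (simp only: fract_poly_pCons emb_add emb_mult)
  have a: "ord (const a) 0" if "a \<noteq> 0"
    using unit_const[OF _ _ that, of R] R ord_unit vring_axioms by (auto simp: pole_ring_def)
  show ?case
  proof (cases "p = 0")
    case True
    then show ?thesis
      using a pCons by (simp add: constF_def)
  next
    case False
    have Xp: "ord (X * emb (Fract p 1)) (int N + int N * int (degree p))"
      using ord_mult[OF ord_x] pCons.IH[OF False] by blast
    show ?thesis
    proof (cases "a = 0")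
      case True
      then show ?thesis
        unfolding eq using Xp False by (simp add: const.hom_zero algebra_simps)
    next
      case a0: False
      have "0 < int N + int N * int (degree p)"
        using N_pos by (simp add: add_pos_nonneg)
      then show ?thesis
        unfolding eq using ord_add[OF a[OF a0] Xp] False by (simp add: algebra_simps)
    qed
  qed
qed simp

text \<open>The order of the quantifiers matters: \<open>k\<close> is chosen before
  \<open>R\<close>, so all poles give \<open>f\<close> the same order. Uniqueness of the pole rests
  on this.\<close>

lemma ord_fract:
  assumes "f \<noteq> 0"
  shows "\<exists>k. \<forall>R. pole_ring R \<longrightarrow> pole_ord R (emb f) (int N * k)"
proof -
  obtain a b where ab: "f = Fract a b" "b \<noteq> 0"
    by (cases f) auto
  have a0: "a \<noteq> 0"
    using assms ab by (auto simp: fract_collapse)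
  have "f = Fract a 1 * inverse (Fract b 1)"
    using ab by simp
  then have f: "emb f = emb (Fract a 1) * inverse (emb (Fract b 1))"
    by (simp only: emb_mult emb.hom_inverse)
  have "pole_ord R (emb f) (int N * (int (degree a) - int (degree b)))" if R: "pole_ring R" for R
  proof -
    interpret vring_pole R X N
      by (rule vring_pole[OF R])
    show ?thesis
      using ord_mult[OF ord_poly[OF R a0] ord_inverse[OF ord_poly[OF R ab(2)]]]
      by (simp add: f right_diff_distrib)
  qed
  then show ?thesis
    by blast
qed

section \<open>An element whose order at the pole is prime to the degree\<close>

definition Y :: "nat \<Rightarrow> 'e" where
  "Y i = y ^ (q ^ i) - (\<Sum>j<i. X ^ (q ^ j + q ^ i))"

text \<open>The factor \<open>X ^ (q - 1)\<close> is chosen so that in \<open>t ^ q\<close> the two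
  monomials \<open>X ^ (1 + q ^ 2)\<close> produced by \<open>Y_Suc\<close> cancel. The same
  cancellation recurs at each further power and gives \<open>t_power\<close>.\<close>

definition t :: 'e where
  "t = Y 1 - X ^ (q - 1) * Y 0"

lemma Y_Suc: "Y (Suc i) = Y i ^ q - X ^ (1 + q ^ Suc i)"
proof -
  have "Y i ^ q = y ^ (q ^ Suc i) - (\<Sum>j<i. X ^ (q ^ Suc j + q ^ Suc i))"
    by (simp add: Y_def E.diff_power E.sum_power algebra_simps flip: power_mult)
  moreover have "(\<Sum>j<Suc i. X ^ (q ^ j + q ^ Suc i)) = X ^ (1 + q ^ Suc i) + (\<Sum>j<i. X ^ (q ^ Suc j + q ^ Suc i))"
    by (subst sum.lessThan_Suc_shift) simp
  ultimately show ?thesis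
    by (simp add: Y_def)
qed

text \<open>\<open>Y i\<close> takes from \<open>s_n2 q n X\<close> exactly the monomials whose
  larger exponent is \<open>q ^ i\<close>, so the defining equation is distributed over the
  \<open>Y i\<close>.\<close>

lemma sum_Y: "(\<Sum>i<n. Y i) = 0"
  using eqn by (simp add: Y_def sum_subtractf addtr_def s_n2_def emb.hom_sum emb.hom_power)

lemma t_power: "t ^ (q ^ k) = Y (Suc k) - X ^ (q ^ Suc k - q ^ k) * Y k"
proof (induction k)
  case (Suc k)
  have le: "q ^ k \<le> q ^ Suc k" "q ^ Suc k \<le> q ^ Suc (Suc k)"
    using q_gt_1 by simp_all
  have e: "(q ^ Suc k - q ^ k) * q = q ^ Suc (Suc k) - q ^ Suc k"
    by (simp add: algebra_simps)
  have "t ^ (q ^ Suc k) = (t ^ (q ^ k)) ^ q"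
    by (simp add: mult.commute flip: power_mult)
  also have "\<dots> = Y (Suc k) ^ q - X ^ (q ^ Suc (Suc k) - q ^ Suc k) * Y k ^ q"
    by (simp only: Suc E.diff_power power_mult_distrib e flip: power_mult)
  also have "\<dots> = Y (Suc (Suc k)) + X ^ (1 + q ^ Suc (Suc k))
      - X ^ (q ^ Suc (Suc k) - q ^ Suc k) * (Y (Suc k) + X ^ (1 + q ^ Suc k))"
    by (simp add: Y_Suc)
  also have "\<dots> = Y (Suc (Suc k)) - X ^ (q ^ Suc (Suc k) - q ^ Suc k) * Y (Suc k)"
    using le(2) by (simp add: ring_distribs flip: power_add)
  finally show ?case .
qed (simp add: t_def)

text \<open>A crude bound, from the fact that no monomial of \<open>s_n2 q n X\<close> has degree
  above \<open>2 * N\<close>. If \<open>?g\<close> had a pole, \<open>?g ^ N\<close> would dominate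
  the equation divided by \<open>X ^ (2 * N)\<close>, while its right-hand side lies in
  \<open>R\<close>.\<close>

lemma y_bound:
  assumes R: "pole_ring R"
  shows "y * inverse X ^ 2 \<in> R"
proof (rule ccontr)
  interpret vring_pole R X N
    by (rule vring_pole[OF R])
  let ?g = "y * inverse X ^ 2" and ?z = "inverse X"
  assume g: "?g \<notin> R"
  have z: "?z \<in> R"
    using inverse_in[OF x_notin] .
  have ig: "inverse ?g \<in> max_ideal" and g0: "?g \<noteq> 0"
    using inverse_in_max_ideal[OF g] g closed by auto
  have y: "y = ?g * X ^ 2"
    using x_nonzero by (simp add: power_inverse)
  \<comment> \<open>With the top power of \<open>?g\<close> taken out, each remaining term carries a
    positive power of \<open>inverse ?g\<close>, so the bracket is a unit.\<close>
  have dec: "addtr q n y * (?z ^ 2) ^ N = ?g ^ N * (1 + (\<Sum>i<n-1. ?z ^ (2 * (N - q ^ i)) * inverse ?g ^ (N - q ^ i)))"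
  proof -
    have "y ^ (q ^ i) * (?z ^ 2) ^ N = ?g ^ N * (?z ^ (2 * (N - q ^ i)) * inverse ?g ^ (N - q ^ i))" if "i < n" for i
    proof -
      have le: "q ^ i \<le> N"
        using that q_gt_1 by (intro power_increasing) auto
      have z2N: "(?z ^ 2) ^ N = (?z ^ 2) ^ (q ^ i) * (?z ^ 2) ^ (N - q ^ i)"
        and gN: "?g ^ N = ?g ^ (q ^ i) * ?g ^ (N - q ^ i)"
        using le by (simp_all flip: power_add)
      have "?g ^ N * ((?z ^ 2) ^ (N - q ^ i) * inverse ?g ^ (N - q ^ i))
          = ?g ^ (q ^ i) * (?z ^ 2) ^ (N - q ^ i) * (?g ^ (N - q ^ i) * inverse ?g ^ (N - q ^ i))"
        by (simp only: gN mult_ac)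
      also have "\<dots> = ?g ^ (q ^ i) * (?z ^ 2) ^ (N - q ^ i)"
        by (simp only: power_mult_inverse_power[OF g0] mult_1_right)
      also have "\<dots> = y ^ (q ^ i) * (?z ^ 2) ^ N"
        by (simp only: z2N power_mult_distrib mult.assoc)
      finally show ?thesis
        by (simp only: power_mult)
    qed
    then have "addtr q n y * (?z ^ 2) ^ N = (\<Sum>i<n. ?g ^ N * (?z ^ (2 * (N - q ^ i)) * inverse ?g ^ (N - q ^ i)))"
      by (simp add: addtr_def sum_distrib_right)
    also have "\<dots> = ?g ^ N * (\<Sum>i<Suc (n - 1). ?z ^ (2 * (N - q ^ i)) * inverse ?g ^ (N - q ^ i))"
      using n by (simp add: sum_distrib_left)
    also have "\<dots> = ?g ^ N * (1 + (\<Sum>i<n-1. ?z ^ (2 * (N - q ^ i)) * inverse ?g ^ (N - q ^ i)))"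
      by (subst sum.lessThan_Suc) (simp only: diff_self_eq_0 mult_0_right power_0 mult_1_right add.commute)
    finally show ?thesis .
  qed
  have "(\<Sum>i<n-1. ?z ^ (2 * (N - q ^ i)) * inverse ?g ^ (N - q ^ i)) \<in> max_ideal"
  proof -
    have "?z ^ (2 * (N - q ^ i)) * inverse ?g ^ (N - q ^ i) \<in> max_ideal" if "i < n - 1" for i
    proof -
      have "q ^ i < N"
        using that q_gt_1 by (intro power_strict_increasing) auto
      then obtain m where m: "N - q ^ i = Suc m"
        using less_imp_Suc_add by (metis add_diff_cancel_left' add_Suc_right)
      have "(?z ^ (2 * (N - q ^ i)) * inverse ?g ^ m) * inverse ?g \<in> max_ideal"
        using ig z max_ideal_subset by (intro max_ideal_mult closed) auto
      then show ?thesis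
        by (simp only: m power_Suc mult_ac)
    qed
    then show ?thesis
      by (intro max_ideal_sum) simp
  qed
  then have u: "unit (1 + (\<Sum>i<n-1. ?z ^ (2 * (N - q ^ i)) * inverse ?g ^ (N - q ^ i)))"
    using unit_add_max_ideal unit_1 by blast
  have "emb (s_n2 q n varF) * (?z ^ 2) ^ N = (\<Sum>k<n. \<Sum>j<k. ?z ^ (2 * N - (q ^ j + q ^ k)))"
  proof -
    have "X ^ (q ^ j + q ^ k) * (?z ^ 2) ^ N = ?z ^ (2 * N - (q ^ j + q ^ k))" if "j < k" "k < n" for j k
    proof -
      have "q ^ j \<le> N" "q ^ k \<le> N"
        using that q_gt_1 by (auto intro!: power_increasing)
      then have "2 * N = (q ^ j + q ^ k) + (2 * N - (q ^ j + q ^ k))"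
        by simp
      then have "(?z ^ 2) ^ N = ?z ^ (q ^ j + q ^ k) * ?z ^ (2 * N - (q ^ j + q ^ k))"
        by (metis power_add power_mult)
      moreover have "X ^ (q ^ j + q ^ k) * ?z ^ (q ^ j + q ^ k) = 1"
        using x_nonzero by (simp add: power_inverse)
      ultimately show ?thesis
        by (simp flip: mult.assoc)
    qed
    then show ?thesis
      by (simp add: s_n2_def emb.hom_sum emb.hom_power sum_distrib_right)
  qed
  also have "\<dots> \<in> R"
    using z by (intro closed)
  finally have "?g ^ N * (1 + (\<Sum>i<n-1. ?z ^ (2 * (N - q ^ i)) * inverse ?g ^ (N - q ^ i))) \<in> R"
    using dec eqn by simp
  then have "?g ^ N \<in> R"
    using unit_mult_in_iff[OF u] by (simp add: mult.commute)
  then show False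
    using g power_in_iff[OF N_pos] by simp
qed

text \<open>The bound is multiplied by \<open>q\<close> at each application of \<open>Y_Suc\<close>;
  the extra monomial respects it because \<open>1 + q ^ Suc i \<le> 2 * q ^ Suc i\<close>.\<close>

lemma Y_bound:
  assumes R: "pole_ring R"
  shows "Y i * inverse X ^ (2 * q ^ i) \<in> R"
proof -
  interpret vring_pole R X N
    by (rule vring_pole[OF R])
  have z: "inverse X \<in> R"
    using inverse_in[OF x_notin] .
  show ?thesis
  proof (induction i)
    case 0
    show ?case
      using y_bound[OF R] by (simp add: Y_def numeral_2_eq_2)
  next
    case (Suc i)
    have le: "1 + q ^ Suc i \<le> 2 * q ^ Suc i"
      using q_gt_1 by (simp add: Suc_le_eq)
    have "Y i ^ q * inverse X ^ (2 * q ^ Suc i) = (Y i * inverse X ^ (2 * q ^ i)) ^ q"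
      by (simp add: power_mult_distrib mult_ac flip: power_mult)
    then have "Y i ^ q * inverse X ^ (2 * q ^ Suc i) \<in> R"
      using Suc closed by metis
    moreover have "inverse X ^ (2 * q ^ Suc i) = inverse X ^ (1 + q ^ Suc i) * inverse X ^ (2 * q ^ Suc i - (1 + q ^ Suc i))"
      using le by (metis le_add_diff_inverse power_add)
    then have "X ^ (1 + q ^ Suc i) * inverse X ^ (2 * q ^ Suc i) = inverse X ^ (2 * q ^ Suc i - (1 + q ^ Suc i))"
      using power_mult_inverse_power[OF x_nonzero, of "1 + q ^ Suc i"]
      by (simp only: mult.assoc[symmetric] mult_1_left)
    then have "X ^ (1 + q ^ Suc i) * inverse X ^ (2 * q ^ Suc i) \<in> R"
      using z closed by metis
    ultimately show ?case
      unfolding Y_Suc left_diff_distrib by (rule closed(4))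
  qed
qed

lemma ord_t:
  assumes R: "pole_ring R"
  shows "pole_ord R t (int (q ^ n + 1))"
proof -
  interpret vring_pole R X N
    by (rule vring_pole[OF R])
  let ?z = "inverse X" and ?w = "Y (n - 1)"
  have z: "?z \<in> R" "?z \<in> max_ideal"
    using inverse_in[OF x_notin] inverse_in_max_ideal[OF x_notin] .
  have qn: "q ^ n = q * N"
    using n by (cases n) auto
  \<comment> \<open>\<open>Y_bound\<close> alone would give the exponent \<open>2 * N\<close>. As
    the \<open>Y i\<close> sum to \<open>0\<close>, \<open>?w\<close> is minus the sum of the
    earlier ones, whose exponents satisfy \<open>2 * q ^ i \<le> q ^ Suc i \<le> N\<close>.\<close>
  have w: "?w * ?z ^ N \<in> R"
  proof -
    have Suc_n: "n = Suc (n - 1)"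
      using n by simp
    have "?w = - (\<Sum>i<n - 1. Y i)"
      using sum_Y by (subst (asm) Suc_n) (simp add: eq_neg_iff_add_eq_0 add.commute)
    moreover have "Y i * ?z ^ N \<in> R" if "i < n - 1" for i
    proof -
      have "2 * q ^ i \<le> q ^ Suc i"
        using q_gt_1 by simp
      also have "\<dots> \<le> N"
        using that q_gt_1 by (intro power_increasing) auto
      finally have "?z ^ N = ?z ^ (2 * q ^ i) * ?z ^ (N - 2 * q ^ i)"
        by (simp flip: power_add)
      then have "Y i * ?z ^ N = (Y i * ?z ^ (2 * q ^ i)) * ?z ^ (N - 2 * q ^ i)"
        by simp
      then show ?thesis
        using Y_bound[OF R, of i] z closed by metis
    qed
    then have "- (\<Sum>i<n - 1. Y i * ?z ^ N) \<in> R"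
      by (intro closed(6) closed(8)) simp
    ultimately show ?thesis
      by (simp add: sum_distrib_right)
  qed
  \<comment> \<open>Multiplication by \<open>?z ^ (q ^ n + 1)\<close> turns the middle term into
    \<open>- 1\<close>. Because \<open>q ^ n = q * N\<close> and \<open>?w * ?z ^ N \<in> R\<close>,
    the two other terms keep a spare factor \<open>?z\<close> and fall into the maximal
    ideal.\<close>
  have "t ^ N = ?w ^ q - X ^ (1 + q ^ n) - X ^ (q ^ n - N) * ?w"
    using t_power[of "n - 1"] Y_Suc[of "n - 1"] n by simp
  moreover have zz: "?z ^ (q ^ n + 1) = ?z * (?z ^ N) ^ q"
    by (simp add: qn mult.commute flip: power_mult)
  have "?w ^ q * ?z ^ (q ^ n + 1) = ?z * (?w * ?z ^ N) ^ q"
    unfolding zz power_mult_distrib by (simp only: mult_ac)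
  moreover have "X ^ (1 + q ^ n) * ?z ^ (q ^ n + 1) = 1"
    using power_mult_inverse_power[OF x_nonzero] by (simp only: add.commute)
  moreover have "X ^ (q ^ n - N) * ?w * ?z ^ (q ^ n + 1) = ?z * (?w * ?z ^ N)"
  proof -
    have "N \<le> q ^ n"
      using q_gt_1 by (simp add: qn)
    then have "q ^ n + 1 = (q ^ n - N) + Suc N"
      by simp
    then have "?z ^ (q ^ n + 1) = ?z ^ (q ^ n - N) * ?z ^ Suc N"
      by (metis power_add)
    then have "X ^ (q ^ n - N) * ?w * ?z ^ (q ^ n + 1)
        = (X ^ (q ^ n - N) * ?z ^ (q ^ n - N)) * (?z * (?w * ?z ^ N))"
      by (simp only: power_Suc mult_ac)
    then show ?thesis
      by (simp only: power_mult_inverse_power[OF x_nonzero] mult_1_left)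
  qed
  ultimately have "t ^ N * ?z ^ (q ^ n + 1) = - 1 + ?z * ((?w * ?z ^ N) ^ q - ?w * ?z ^ N)"
    by (simp only: left_diff_distrib) (simp add: algebra_simps)
  moreover have "((?w * ?z ^ N) ^ q - ?w * ?z ^ N) * ?z \<in> max_ideal"
    using max_ideal_mult[OF closed(4)[OF closed(7)[OF w] w] z(2)] .
  moreover have "unit (- 1)"
    by (simp add: unit_def closed)
  ultimately have "unit (t ^ N * ?z ^ (q ^ n + 1))"
    using unit_add_max_ideal by (simp only: mult.commute)
  moreover have "X powi (- int (q ^ n + 1)) = ?z ^ (q ^ n + 1)"
    by (simp only: power_int_minus power_int_of_nat power_inverse)
  ultimately show ?thesis
    unfolding ord_def by simp
qed

lemma exists_pole_ring: "\<exists>R. pole_ring R"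
proof -
  \<comment> \<open>The image of the ring of rational functions that are regular at infinity; it
    contains \<open>inverse X\<close> but not \<open>X\<close>, as Chevalley's theorem asks.\<close>
  define S where "S = emb ` {Fract a b | a b. b \<noteq> 0 \<and> degree a \<le> degree b}"
  have mem: "emb (Fract a b) \<in> S" if "b \<noteq> 0" "degree a \<le> degree b" for a b
    using that by (auto simp: S_def)
  have S: "subring S"
    unfolding subring_def
  proof (intro conjI ballI)
    show "0 \<in> S"
      using mem[of 1 0] by (simp add: emb.hom_zero fract_collapse)
    show "1 \<in> S"
      using mem[of 1 1] by (simp add: emb.hom_one fract_collapse)
    fix u v assume "u \<in> S" "v \<in> S"
    then obtain a b c d where u: "u = emb (Fract a b)" "b \<noteq> 0" "degree a \<le> degree b"
      and v: "v = emb (Fract c d)" "d \<noteq> 0" "degree c \<le> degree d"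
      by (auto simp: S_def)
    have deg: "degree (a * d) \<le> degree (b * d)" "degree (c * b) \<le> degree (b * d)"
      "degree (a * c) \<le> degree (b * d)"
      using u v degree_mult_le[of a d] degree_mult_le[of c b] degree_mult_le[of a c]
      by (auto simp: degree_mult_eq)
    have "emb (Fract (a * d + c * b) (b * d)) \<in> S" "emb (Fract (a * d - c * b) (b * d)) \<in> S"
      "emb (Fract (a * c) (b * d)) \<in> S"
      using u v deg by (auto intro!: mem degree_add_le degree_diff_le)
    then show "u + v \<in> S" "u - v \<in> S" "u * v \<in> S"
      using u v by (simp_all flip: emb_add emb.hom_diff emb_mult)
  qed
  have "inverse X = emb (Fract 1 [:0, 1:])"
    by (simp add: varF_def flip: emb.hom_inverse)
  then have "inverse X \<in> S"
    using mem[of "[:0, 1:]" 1] by simp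
  moreover have "X \<notin> S"
  proof
    assume "X \<in> S"
    then obtain a b :: "'k poly" where ab: "varF = Fract a b" "b \<noteq> 0" "degree a \<le> degree b"
      by (auto simp: S_def emb.hom_eq_iff)
    then have "pCons 0 b = a"
      by (simp add: varF_def eq_fract)
    then show False
      using ab by auto
  qed
  ultimately obtain R where R: "subring R" "S \<subseteq> R" "X \<notin> R" "\<And>z. z \<notin> R \<Longrightarrow> inverse z \<in> R"
    using valuation_ring_avoiding[OF S] by metis
  have "KE emb \<subseteq> S"
    using mem[of 1] by (auto simp: KE_def constF_def)
  then have "pole_ring R"
    using R by (auto simp: pole_ring_def vring_def)
  then show ?thesis ..
qed

lemma ord_hom_poly_t:
  assumes p: "p \<noteq> 0" "degree p < N"
  shows "\<exists>k. \<forall>R. pole_ring R \<longrightarrow> pole_ord R (emb.hom_poly t p) k"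
proof -
  have "\<exists>k. coeff p i \<noteq> 0 \<longrightarrow> (\<forall>R. pole_ring R \<longrightarrow> pole_ord R (emb (coeff p i)) (int N * k))" for i
    using ord_fract[of "coeff p i"] by blast
  then obtain d where d: "\<And>i R. coeff p i \<noteq> 0 \<Longrightarrow> pole_ring R \<Longrightarrow> pole_ord R (emb (coeff p i)) (int N * d i)"
    by metis
  \<comment> \<open>Zero has no order, so vanishing coefficients have to be left out before the
    orders are compared.\<close>
  define I where "I = {i. i \<le> degree p \<and> coeff p i \<noteq> 0}"
  define k where "k i = int N * d i + int i * int (q ^ n + 1)" for i
  have I: "finite I" "I \<noteq> {}"
    using p(1) by (auto simp: I_def intro!: exI[of _ "degree p"])
  have "coprime N (q ^ n + 1)"
  proof -
    have "N dvd q ^ n"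
      by (simp add: le_imp_power_dvd)
    moreover have "coprime (q ^ n) (q ^ n + 1)"
      by simp
    ultimately show ?thesis
      using coprime_divisors[of N "q ^ n" "q ^ n + 1" "q ^ n + 1"] by simp
  qed
  then have cop: "coprime (int N) (int (q ^ n + 1))"
    by (simp only: coprime_int_iff)
  have inj: "inj_on k I"
  proof
    fix i j assume ij: "i \<in> I" "j \<in> I" "k i = k j"
    then have "(int i - int j) * int (q ^ n + 1) = int N * (d j - d i)"
      by (simp add: k_def algebra_simps)
    then have "int N dvd (int i - int j) * int (q ^ n + 1)"
      by (metis dvd_triv_left)
    then have "int N dvd int i - int j"
      using cop coprime_dvd_mult_left_iff by blast
    moreover have "\<bar>int i - int j\<bar> < int N"
      using ij p(2) by (auto simp: I_def simp del: of_nat_power)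
    ultimately show "i = j"
      using dvd_imp_le_int[of "int i - int j" "int N"] by linarith
  qed
  have "pole_ord R (emb.hom_poly t p) (Max (k ` I))" if R: "pole_ring R" for R
  proof -
    interpret vring_pole R X N
      by (rule vring_pole[OF R])
    have "emb.hom_poly t p = (\<Sum>i\<in>I. emb (coeff p i) * t ^ i)"
      unfolding emb.hom_poly_altdef I_def
      by (rule sum.mono_neutral_right) (auto simp: emb.hom_zero)
    moreover have "ord (emb (coeff p i) * t ^ i) (k i)" if "i \<in> I" for i
      unfolding k_def using that d[OF _ R] ord_power[OF ord_t[OF R]]
      by (intro ord_mult) (auto simp: I_def)
    ultimately show ?thesis
      using ord_sum[OF I _ inj] by simp
  qed
  then show ?thesis by blast
qed

lemma hom_poly_t_nonzero:
  assumes "p \<noteq> 0" "degree p < N"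
  shows "emb.hom_poly t p \<noteq> 0"
proof -
  obtain R where R: "pole_ring R"
    using exists_pole_ring ..
  interpret vring_pole R X N
    by (rule vring_pole[OF R])
  show ?thesis
    using ord_hom_poly_t[OF assms] R ord_nonzero by blast
qed

section \<open>The degree of the extension: powers of \<open>t\<close> against powers of
  \<open>y\<close>\<close>

sublocale V: vector_space "\<lambda>(f :: 'k poly fract) (z :: 'e). emb f * z"
  by unfold_locales (simp_all add: emb_add emb_mult emb_one algebra_simps)

lemma inj_on_t_power: "inj_on (\<lambda>i. t ^ i) {..<N}"
proof
  fix i j assume ij: "i \<in> {..<N}" "j \<in> {..<N}" "t ^ i = t ^ j"
  let ?p = "monom 1 i - monom 1 j :: 'k poly fract poly"
  have "degree ?p \<le> max i j"
    by (intro degree_diff_le) (auto simp: degree_monom_eq)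
  moreover have "emb.hom_poly t ?p = 0"
    using ij by (simp add: emb.hom_poly_diff emb.hom_poly_monom)
  ultimately have "?p = 0"
    using hom_poly_t_nonzero[of ?p] ij by fastforce
  then have "coeff (monom (1 :: 'k poly fract) i) i = coeff (monom 1 j) i"
    by simp
  then show "i = j"
    by (simp split: if_splits)
qed

lemma card_t_powers: "card ((\<lambda>i. t ^ i) ` {..<N}) = N"
  using card_image[OF inj_on_t_power] by (rule trans) (rule card_lessThan)

lemma sum_t_power: "(\<Sum>v\<in>(\<lambda>i. t ^ i) ` {..<N}. emb (u v) * v) = emb.hom_poly t (\<Sum>i<N. monom (u (t ^ i)) i)"
proof -
  have "(\<Sum>v\<in>(\<lambda>i. t ^ i) ` {..<N}. emb (u v) * v) = (\<Sum>i<N. emb (u (t ^ i)) * t ^ i)"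
    by (subst sum.reindex[OF inj_on_t_power]) (simp add: o_def)
  then show ?thesis
    by (simp add: emb.hom_poly_sum emb.hom_poly_monom)
qed

lemma degree_sum_monom: "degree (\<Sum>i<N. monom (c i :: 'k poly fract) i) < N"
proof -
  have "degree (\<Sum>i<N. monom (c i) i) \<le> N - 1"
    by (intro degree_sum_le) (auto intro: order_trans[OF degree_monom_le])
  then show ?thesis
    using q_gt_1 by (simp add: le_less_trans)
qed

lemma independent_t_powers: "V.independent ((\<lambda>i. t ^ i) ` {..<N})"
proof
  assume "V.dependent ((\<lambda>i. t ^ i) ` {..<N})"
  then obtain u j where u: "j < N" "u (t ^ j) \<noteq> 0"
    "(\<Sum>v\<in>(\<lambda>i. t ^ i) ` {..<N}. emb (u v) * v) = 0"
    by (subst (asm) V.dependent_finite) auto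
  let ?p = "\<Sum>i<N. monom (u (t ^ i)) i"
  have "coeff ?p j = u (t ^ j)"
    using u(1) by (simp add: coeff_sum)
  then have "?p \<noteq> 0"
    using u(2) by auto
  then show False
    using u(3) hom_poly_t_nonzero[OF _ degree_sum_monom] unfolding sum_t_power by simp
qed

definition M :: "'k poly fract poly" where
  "M = addtr_poly q n (s_n2 q n varF)"

lemma M: "degree M = N" "M \<noteq> 0"
  using addtr_poly[of q n "s_n2 q n varF :: 'k poly fract"] q_gt_1 n by (simp_all add: M_def)

lemma hom_poly_M:
  assumes "field_hom \<phi>"
  shows "field_hom.hom_poly \<phi> z M = addtr q n z - \<phi> (s_n2 q n varF)"
proof -
  interpret field_hom \<phi> by fact
  show ?thesis
    by (simp add: M_def addtr_poly_def addtr_def hom_poly_diff hom_poly_sum hom_poly_monom hom_one)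
qed

lemma M_y: "emb.hom_poly y M = 0"
  using hom_poly_M[OF emb.field_hom_axioms] eqn by simp

lemma range_hom_poly_y: "range (emb.hom_poly y) = UNIV"
proof (rule gen)
  show "is_subfield (range (emb.hom_poly y))"
    using emb.is_subfield_range_hom_poly M(2) M_y by blast
  show "range emb \<subseteq> range (emb.hom_poly y)"
  proof
    fix z assume "z \<in> range emb"
    then obtain f where "z = emb f"
      by blast
    then have "z = emb.hom_poly y [:f:]"
      by simp
    then show "z \<in> range (emb.hom_poly y)"
      by blast
  qed
  have "y = emb.hom_poly y [:0, 1:]"
    by (simp add: emb.hom_zero emb.hom_one)
  then show "y \<in> range (emb.hom_poly y)"
    by (metis rangeI)
qed

lemma hom_poly_mod:
  assumes "emb.hom_poly y m = 0"
  shows "emb.hom_poly y (p mod m) = emb.hom_poly y p"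
proof -
  have "emb.hom_poly y p = emb.hom_poly y (p div m) * emb.hom_poly y m + emb.hom_poly y (p mod m)"
    by (simp flip: emb.hom_poly_mult emb.hom_poly_add)
  then show ?thesis
    using assms by simp
qed

lemma in_span_y_powers:
  assumes "m \<noteq> 0" "emb.hom_poly y m = 0"
  shows "z \<in> V.span ((\<lambda>i. y ^ i) ` {..<degree m})"
proof -
  obtain p where "z = emb.hom_poly y p"
    using range_hom_poly_y by (metis UNIV_I imageE)
  then have z: "z = emb.hom_poly y (p mod m)"
    by (simp add: hom_poly_mod assms)
  show ?thesis
  proof (cases "p mod m = 0")
    case True
    then show ?thesis
      by (simp add: z V.span_zero)
  next
    case False
    then have "degree (p mod m) < degree m"
      using degree_mod_less[OF assms(1), of p] by simp
    then show ?thesis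
      unfolding z emb.hom_poly_altdef by (intro V.span_sum V.span_scale V.span_base) auto
  qed
qed

text \<open>The powers of \<open>y\<close> below \<open>degree m\<close> span \<open>E\<close>, so
  they cannot be fewer than the \<open>N\<close> independent powers of \<open>t\<close>. As
  \<open>M\<close> has degree \<open>N\<close>, it is a minimal polynomial of
  \<open>y\<close>.\<close>

lemma degree_ge_N:
  assumes "m \<noteq> 0" "emb.hom_poly y m = 0"
  shows "N \<le> degree m"
proof -
  have "card ((\<lambda>i. t ^ i) ` {..<N}) \<le> card ((\<lambda>i. y ^ i) ` {..<degree m})"
    using in_span_y_powers[OF assms]
    by (intro conjunct2[OF V.independent_span_bound[OF _ independent_t_powers]] finite_imageI finite_lessThan subsetI)
  also have "\<dots> \<le> degree m"
    using card_image_le[of "{..<degree m}" "\<lambda>i. y ^ i"] by simp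
  finally show ?thesis
    unfolding card_t_powers .
qed

lemma M_dvd:
  assumes "emb.hom_poly y p = 0"
  shows "M dvd p"
proof -
  have "emb.hom_poly y (p mod M) = 0"
    using hom_poly_mod[OF M_y] assms by simp
  then have "p mod M = 0"
    using degree_ge_N[of "p mod M"] degree_mod_less[OF M(2), of p] M(1) by fastforce
  then show ?thesis
    by auto
qed

text \<open>\<open>E\<close> is spanned by at most \<open>N\<close> powers of \<open>y\<close>, so
  an element outside the span of the powers of \<open>t\<close> would give one independent element
  too many.\<close>

lemma exists_hom_poly_t: "\<exists>p. degree p < N \<and> z = emb.hom_poly t p"
proof -
  let ?T = "(\<lambda>i. t ^ i) ` {..<N}"
  have "z \<in> V.span ?T"
  proof (rule ccontr)
    assume z: "z \<notin> V.span ?T"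
    then have "V.independent (insert z ?T)"
      using V.independent_insertI independent_t_powers by blast
    then have "card (insert z ?T) \<le> card ((\<lambda>i. y ^ i) ` {..<degree M})"
      using in_span_y_powers[OF M(2) M_y]
      by (intro conjunct2[OF V.independent_span_bound] finite_imageI finite_lessThan subsetI)
    also have "\<dots> \<le> N"
      using card_image_le[of "{..<degree M}" "\<lambda>i. y ^ i"] by (simp add: M)
    also have "card (insert z ?T) = Suc (card ?T)"
      using z V.span_base[of z ?T] by (intro card_insert_disjoint) auto
    also have "card ?T = N"
      by (rule card_t_powers)
    finally show False by simp
  qed
  then obtain u where "z = (\<Sum>v\<in>?T. emb (u v) * v)"
    by (subst (asm) V.span_finite) auto
  then have "z = emb.hom_poly t (\<Sum>i<N. monom (u (t ^ i)) i)"
    unfolding sum_t_power .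
  then show ?thesis
    using degree_sum_monom[of "\<lambda>i. u (t ^ i)"] by (intro exI conjI)
qed

lemma ord_exists:
  assumes "z \<noteq> 0"
  shows "\<exists>k. \<forall>R. pole_ring R \<longrightarrow> pole_ord R z k"
proof -
  obtain p where p: "degree p < N" "z = emb.hom_poly t p"
    using exists_hom_poly_t by blast
  then have "p \<noteq> 0"
    using assms by auto
  then show ?thesis
    unfolding p(2) using p(1) by (rule ord_hom_poly_t)
qed

lemma pole_ring_unique:
  assumes "pole_ring R" "pole_ring R'"
  shows "R = R'"
proof -
  interpret R: vring_pole R X N
    by (rule vring_pole[OF assms(1)])
  interpret R': vring_pole R' X N
    by (rule vring_pole[OF assms(2)])
  have "z \<in> R \<longleftrightarrow> z \<in> R'" for z
  proof (cases "z = 0")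
    case True
    then show ?thesis
      using R.closed R'.closed by simp
  next
    case False
    then obtain k where "R.ord z k" "R'.ord z k"
      using ord_exists assms by blast
    then show ?thesis
      using R.ord_in_iff R'.ord_in_iff by simp
  qed
  then show ?thesis
    by blast
qed


section \<open>The automorphisms\<close>

text \<open>The universal property of \<open>K(x)[Y] / (M)\<close>: \<open>M_dvd\<close> says that
  polynomials with the same value at \<open>y\<close> differ by a multiple of \<open>M\<close>, so
  any of them may be chosen to define \<sigma>.\<close>

lemma extend_hom:
  assumes \<phi>: "field_hom \<phi>" and z: "addtr q n z = \<phi> (s_n2 q n varF)"
  shows "\<exists>\<sigma>. field_hom \<sigma> \<and> (\<forall>f. \<sigma> (emb f) = \<phi> f) \<and> \<sigma> y = z"
proof -
  interpret \<phi>: field_hom \<phi> by fact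
  have wd: "\<phi>.hom_poly z p = \<phi>.hom_poly z r" if "emb.hom_poly y p = emb.hom_poly y r" for p r
  proof -
    have "M dvd p - r"
      using that M_dvd[of "p - r"] by (simp add: emb.hom_poly_diff)
    then obtain s where "p - r = M * s" ..
    then have "\<phi>.hom_poly z (p - r) = 0"
      using hom_poly_M[OF \<phi>, of z] z by (simp add: \<phi>.hom_poly_mult)
    then show ?thesis
      by (simp add: \<phi>.hom_poly_diff)
  qed
  define \<sigma> where "\<sigma> w = \<phi>.hom_poly z (SOME p. emb.hom_poly y p = w)" for w
  have \<sigma>: "\<sigma> (emb.hom_poly y p) = \<phi>.hom_poly z p" for p
    unfolding \<sigma>_def by (rule wd) (rule someI[of _ p], rule refl)
  have ex: "\<exists>p. w = emb.hom_poly y p" for w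
    using range_hom_poly_y by (metis UNIV_I imageE)
  have "field_hom \<sigma>"
  proof
    fix a b
    obtain p r where "a = emb.hom_poly y p" "b = emb.hom_poly y r"
      using ex by metis
    then show "\<sigma> (a + b) = \<sigma> a + \<sigma> b" "\<sigma> (a * b) = \<sigma> a * \<sigma> b"
      by (simp_all only: \<sigma> \<phi>.hom_poly_add \<phi>.hom_poly_mult flip: emb.hom_poly_add emb.hom_poly_mult)
  next
    show "\<sigma> 1 = 1"
      using \<sigma>[of 1] by simp
  qed
  moreover have "\<sigma> (emb f) = \<phi> f" for f
    using \<sigma>[of "[:f:]"] by simp
  moreover have "\<sigma> y = z"
    using \<sigma>[of "[:0, 1:]"] by (simp add: emb.hom_zero emb.hom_one \<phi>.hom_zero \<phi>.hom_one)
  ultimately show ?thesis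
    by blast
qed

abbreviation T :: "'k \<Rightarrow> 'k" where "T \<tau> \<equiv> \<Sum>i\<in>{1..<n}. \<tau> ^ (q ^ i)"

lemma s_n2_X_shift:
  "s_n2 q n (X + const \<tau>) = s_n2 q n X + const (s_n2 q n \<tau>) + addtr q n (X * const (T \<tau>))"
  using E.s_n2_add[of n "const \<tau>" X] n
  by (simp add: const.hom_s_n2 const.hom_sum const.hom_power power_qn flip: const.hom_power)

text \<open>The value intended for \<open>\<sigma> y\<close> has to solve the defining equation at
  \<open>X + const \<tau>\<close>. By \<open>s_n2_X_shift\<close> the summand
  \<open>X * const (T \<tau>)\<close> accounts for the mixed terms and \<delta> for
  \<open>s_n2 q n \<tau>\<close>. Injectivity is automatic; for surjectivity the range of \<sigma>
  is a subfield to which \<open>gen\<close> applies.\<close>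

lemma exists_sigma:
  assumes "addtr q n \<delta> = s_n2 q n \<tau>"
  shows "\<exists>\<sigma>. is_sigma q n emb y \<tau> \<delta> \<sigma>"
proof -
  define \<phi> where "\<phi> f = emb (shiftF \<tau> f)" for f
  interpret S: field_hom "shiftF \<tau>"
    by (rule field_hom_shiftF)
  interpret \<phi>: field_hom \<phi>
    by unfold_locales (simp_all add: \<phi>_def S.hom_add S.hom_mult S.hom_one emb_add emb_mult emb_one)
  define z where "z = y + X * const (T \<tau>) + const \<delta>"
  have \<phi>X: "\<phi> varF = X + const \<tau>"
    by (simp add: \<phi>_def shiftF_varF emb_add)
  have "addtr q n z = addtr q n y + addtr q n (X * const (T \<tau>)) + const (addtr q n \<delta>)"
    by (simp add: z_def E.addtr_add const.hom_addtr)
  also have "\<dots> = \<phi> (s_n2 q n varF)"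
    unfolding \<phi>.hom_s_n2 \<phi>X s_n2_X_shift by (simp add: eqn emb.hom_s_n2 assms)
  finally obtain \<sigma> where \<sigma>: "field_hom \<sigma>" "\<And>f. \<sigma> (emb f) = \<phi> f" "\<sigma> y = z"
    using extend_hom[OF \<phi>.field_hom_axioms] by blast
  interpret \<sigma>: field_hom \<sigma> by fact
  have c: "\<sigma> (const c) = const c" for c
    by (simp add: \<sigma>(2) \<phi>_def shiftF_constF)
  have X: "\<sigma> X = X + const \<tau>"
    by (simp add: \<sigma>(2) \<phi>X)
  have sub: "range emb \<subseteq> range \<sigma>"
  proof -
    have "X = \<sigma> (X - const \<tau>)"
      by (simp add: \<sigma>.hom_diff X c)
    then have "varF \<in> emb -` range \<sigma>"
      by blast
    moreover have "constF a \<in> emb -` range \<sigma>" for a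
      using c[of a] by (intro vimageI2 range_eqI[of _ _ "const a"]) simp
    ultimately have "f \<in> emb -` range \<sigma>" for f
      using subfield_of_fract[OF emb.is_subfield_vimage[OF \<sigma>.is_subfield_range]] by blast
    then show ?thesis
      by blast
  qed
  have "range \<sigma> = UNIV"
  proof (rule gen)
    have "y = z - (X * const (T \<tau>) + const \<delta>)"
      by (simp add: z_def)
    moreover have "z \<in> range \<sigma>"
      using \<sigma>(3) by blast
    moreover have "X * const (T \<tau>) + const \<delta> \<in> range \<sigma>"
    proof -
      have "X * const (T \<tau>) + const \<delta> = emb (varF * constF (T \<tau>) + constF \<delta>)"
        by (simp add: emb_add emb_mult)
      then show ?thesis
        using sub by auto
    qed
    ultimately show "y \<in> range \<sigma>"
      using is_subfield_diff[OF \<sigma>.is_subfield_range] by simp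
  qed (use sub \<sigma>.is_subfield_range in auto)
  then have "bij \<sigma>"
    by (simp add: bij_def inj_def \<sigma>.hom_eq_iff)
  then show ?thesis
    using X c \<sigma>(3) \<sigma>.hom_add \<sigma>.hom_mult \<sigma>.hom_one
    unfolding is_sigma_def is_K_aut_def KE_def z_def by blast
qed

lemma hom_eqI:
  assumes "field_hom \<sigma>" "field_hom \<rho>"
    and c: "\<And>c. \<sigma> (const c) = \<rho> (const c)" and X: "\<sigma> X = \<rho> X" and y: "\<sigma> y = \<rho> y"
  shows "\<sigma> = \<rho>"
proof -
  interpret \<sigma>: field_hom \<sigma> by fact
  interpret \<rho>: field_hom \<rho> by fact
  let ?L = "{z. \<sigma> z = \<rho> z}"
  have L: "is_subfield ?L"
    by (simp add: is_subfield_def \<sigma>.hom_zero \<sigma>.hom_one \<sigma>.hom_add \<sigma>.hom_diff \<sigma>.hom_mult \<sigma>.hom_inverse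
        \<rho>.hom_zero \<rho>.hom_one \<rho>.hom_add \<rho>.hom_diff \<rho>.hom_mult \<rho>.hom_inverse)
  have "f \<in> emb -` ?L" for f
    by (rule subfield_of_fract[OF emb.is_subfield_vimage[OF L]]) (simp_all add: c X)
  then have "?L = UNIV"
    using L y by (intro gen) auto
  then show ?thesis
    by auto
qed

lemma is_sigmaD:
  assumes "is_sigma q n emb y \<tau> \<delta> \<sigma>"
  shows "field_hom \<sigma>" "bij \<sigma>" "\<sigma> (const c) = const c" "\<sigma> X = X + const \<tau>"
    "\<sigma> y = y + X * const (T \<tau>) + const \<delta>"
  using assms field_hom_K_aut[of "KE emb" \<sigma>] const_in_KE[of c]
  by (auto simp: is_sigma_def is_K_aut_def)

lemma is_sigma_unique:
  "is_sigma q n emb y \<tau> \<delta> \<sigma> \<Longrightarrow> is_sigma q n emb y \<tau> \<delta> \<rho> \<Longrightarrow> \<sigma> = \<rho>"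
  by (rule hom_eqI) (simp_all add: is_sigmaD)

lemma is_sigma_inject:
  assumes "is_sigma q n emb y \<tau> \<delta> \<sigma>" "is_sigma q n emb y \<tau>' \<delta>' \<sigma>"
  shows "\<tau> = \<tau>' \<and> \<delta> = \<delta>'"
proof -
  have "\<tau> = \<tau>'"
    using is_sigmaD(4)[OF assms(1)] is_sigmaD(4)[OF assms(2)] by (simp add: const.hom_eq_iff)
  then show ?thesis
    using is_sigmaD(5)[OF assms(1)] is_sigmaD(5)[OF assms(2)] by (simp add: const.hom_eq_iff)
qed

section \<open>The group law on the pairs of parameters\<close>

lemma T_add: "T (\<tau> + \<tau>') = T \<tau> + T \<tau>'"
  by (simp add: K.add_pow sum.distrib)

lemma T_uminus: "T (- \<tau>) = - T \<tau>"
  by (simp add: K.uminus_pow sum_negf)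

lemma T_0: "T 0 = 0"
  using q_gt_1 by (simp add: power_0_left)

lemma s_n2_add_K: "s_n2 q n (\<tau> + \<tau>') = s_n2 q n \<tau> + s_n2 q n \<tau>' + addtr q n (\<tau> * T \<tau>')"
  using K.s_n2_add[OF _ power_qn] n by simp

text \<open>The term \<open>\<tau> * T \<tau>'\<close> arises when \<sigma> shifts the
  \<open>X\<close> in \<open>\<rho> y\<close>. It is also the correction in
  \<open>s_n2_add_K\<close>, so the condition on the parameters is preserved.\<close>

lemma is_sigma_comp:
  assumes "is_sigma q n emb y \<tau> \<delta> \<sigma>" "is_sigma q n emb y \<tau>' \<delta>' \<rho>"
  shows "is_sigma q n emb y (\<tau> + \<tau>') (\<delta> + \<delta>' + \<tau> * T \<tau>') (\<sigma> \<circ> \<rho>)"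
proof -
  interpret \<sigma>: field_hom \<sigma>
    using is_sigmaD(1)[OF assms(1)] .
  note \<sigma> = is_sigmaD[OF assms(1)] and \<rho> = is_sigmaD[OF assms(2)]
  have "(\<sigma> \<circ> \<rho>) X = X + const (\<tau> + \<tau>')"
    by (simp add: \<rho>(4) \<sigma>(3,4) \<sigma>.hom_add const.hom_add)
  moreover have "(\<sigma> \<circ> \<rho>) y = y + X * const (T (\<tau> + \<tau>')) + const (\<delta> + \<delta>' + \<tau> * T \<tau>')"
    unfolding T_add o_apply \<rho>(5) \<sigma>.hom_add \<sigma>.hom_mult \<sigma>(3,4,5) const.hom_add const.hom_mult
    by (simp add: algebra_simps)
  moreover have "is_K_aut (KE emb) (\<sigma> \<circ> \<rho>)"
    using assms by (intro is_K_aut_comp) (auto simp: is_sigma_def)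
  ultimately show ?thesis
    unfolding is_sigma_def by blast
qed

text \<open>The parameters come from setting the composite in \<open>is_sigma_comp\<close> equal to
  \<open>(0, 0)\<close>, with \<open>T (- \<tau>) = - T \<tau>\<close>.\<close>

lemma is_sigma_inv:
  assumes "is_sigma q n emb y \<tau> \<delta> \<sigma>"
  shows "is_sigma q n emb y (- \<tau>) (\<tau> * T \<tau> - \<delta>) (inv \<sigma>)"
proof -
  interpret \<sigma>: field_hom \<sigma>
    using is_sigmaD(1)[OF assms(1)] .
  note \<sigma> = is_sigmaD[OF assms]
  have eq: "inv \<sigma> z = w" if "\<sigma> w = z" for z w
    using that \<sigma>(2) by (simp add: bij_is_inj inv_f_eq)
  have "inv \<sigma> X = X + const (- \<tau>)"
    by (rule eq) (simp add: \<sigma>(3,4) \<sigma>.hom_diff const.hom_uminus)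
  moreover have "inv \<sigma> y = y + X * const (T (- \<tau>)) + const (\<tau> * T \<tau> - \<delta>)"
    unfolding T_uminus
    by (rule eq, unfold \<sigma>.hom_add \<sigma>.hom_diff \<sigma>.hom_uminus \<sigma>.hom_mult \<sigma>(3,4,5) const.hom_uminus const.hom_diff const.hom_mult)
      (simp add: algebra_simps)
  moreover have "is_K_aut (KE emb) (inv \<sigma>)"
    using assms by (intro is_K_aut_inv) (auto simp: is_sigma_def)
  ultimately show ?thesis
    unfolding is_sigma_def by blast
qed

lemma is_sigma_id: "is_sigma q n emb y 0 0 id"
  unfolding is_sigma_def T_0 by (simp add: is_K_aut_def const.hom_zero)

lemma id_in_Gamma: "id \<in> Gamma q n emb y"
proof -
  have "addtr q n (0 :: 'k) = 0"
    using q_gt_1 by (simp add: addtr_def power_0_left)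
  then show ?thesis
    unfolding Gamma_def using is_sigma_id K.s_n2_0 by (metis (mono_tags, lifting) mem_Collect_eq)
qed

lemma comp_in_Gamma:
  assumes "\<sigma> \<in> Gamma q n emb y" "\<rho> \<in> Gamma q n emb y"
  shows "\<sigma> \<circ> \<rho> \<in> Gamma q n emb y"
proof -
  obtain \<tau> \<delta> \<tau>' \<delta>' where s: "addtr q n \<delta> = s_n2 q n \<tau>" "is_sigma q n emb y \<tau> \<delta> \<sigma>"
    "addtr q n \<delta>' = s_n2 q n \<tau>'" "is_sigma q n emb y \<tau>' \<delta>' \<rho>"
    using assms unfolding Gamma_def by blast
  have "addtr q n (\<delta> + \<delta>' + \<tau> * T \<tau>') = s_n2 q n (\<tau> + \<tau>')"
    unfolding s_n2_add_K K.addtr_add s(1,3) ..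
  then show ?thesis
    unfolding Gamma_def using is_sigma_comp[OF s(2,4)] by blast
qed

lemma inv_in_Gamma:
  assumes "\<sigma> \<in> Gamma q n emb y"
  shows "inv \<sigma> \<in> Gamma q n emb y"
proof -
  obtain \<tau> \<delta> where s: "addtr q n \<delta> = s_n2 q n \<tau>" "is_sigma q n emb y \<tau> \<delta> \<sigma>"
    using assms unfolding Gamma_def by blast
  have "s_n2 q n (- \<tau>) + s_n2 q n \<tau> - addtr q n (\<tau> * T \<tau>) = 0"
    using s_n2_add_K[of "- \<tau>" \<tau>] K.s_n2_0 K.addtr_uminus[of n "\<tau> * T \<tau>"] by simp
  then have "addtr q n (\<tau> * T \<tau> - \<delta>) = s_n2 q n (- \<tau>)"
    unfolding K.addtr_diff s(1) by (simp add: algebra_simps)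
  then show ?thesis
    unfolding Gamma_def using is_sigma_inv[OF s(2)] by blast
qed

lemma Gamma_image_subset:
  assumes "\<sigma> \<in> Gamma q n emb y"
  shows "\<sigma> ` range emb \<subseteq> range emb"
proof -
  obtain \<tau> \<delta> where s: "is_sigma q n emb y \<tau> \<delta> \<sigma>"
    using assms unfolding Gamma_def by blast
  interpret \<sigma>: field_hom \<sigma>
    using is_sigmaD(1)[OF s] .
  have L: "is_subfield (emb -` (\<sigma> -` range emb))"
    by (intro emb.is_subfield_vimage \<sigma>.is_subfield_vimage emb.is_subfield_range)
  have "\<sigma> X = emb (varF + constF \<tau>)"
    by (simp add: is_sigmaD(4)[OF s] emb_add)
  then have v: "varF \<in> emb -` (\<sigma> -` range emb)"
    by simp
  have c: "constF a \<in> emb -` (\<sigma> -` range emb)" for a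
    using is_sigmaD(3)[OF s, of a] by simp
  show ?thesis
    using subfield_of_fract[OF L c v] by auto
qed

lemma Gamma_image:
  assumes "\<sigma> \<in> Gamma q n emb y"
  shows "\<sigma> ` range emb = range emb"
proof (rule equalityI)
  show "range emb \<subseteq> \<sigma> ` range emb"
  proof
    fix z assume z: "z \<in> range emb"
    obtain \<tau> \<delta> where "is_sigma q n emb y \<tau> \<delta> \<sigma>"
      using assms unfolding Gamma_def by blast
    then have "bij \<sigma>"
      by (rule is_sigmaD(2))
    then have "z = \<sigma> (inv \<sigma> z)"
      by (simp add: bij_is_surj surj_f_inv_f)
    then show "z \<in> \<sigma> ` range emb"
      using Gamma_image_subset[OF inv_in_Gamma[OF assms]] z by blast
  qed
qed (rule Gamma_image_subset[OF assms])

lemma card_Gamma: "card (Gamma q n emb y) = q ^ (2 * n - 1)"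
proof -
  let ?S = "{(\<tau> :: 'k, \<delta>). addtr q n \<delta> = s_n2 q n \<tau>}"
  define g where "g = (\<lambda>(\<tau>, \<delta>). SOME \<sigma>. is_sigma q n emb y \<tau> \<delta> \<sigma>)"
  have g: "is_sigma q n emb y \<tau> \<delta> (g (\<tau>, \<delta>))" if "addtr q n \<delta> = s_n2 q n \<tau>" for \<tau> \<delta>
    unfolding g_def using someI_ex[OF exists_sigma[OF that]] by simp
  have "inj_on g ?S"
  proof (rule inj_onI)
    fix u v assume uv: "u \<in> ?S" "v \<in> ?S" "g u = g v"
    obtain \<tau> \<delta> where u: "u = (\<tau>, \<delta>)"
      by (cases u)
    obtain \<tau>' \<delta>' where v: "v = (\<tau>', \<delta>')"
      by (cases v)
    show "u = v"
      using is_sigma_inject[OF g[of \<delta> \<tau>], of \<tau>' \<delta>'] g[of \<delta>' \<tau>'] uv by (simp add: u v)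
  qed
  moreover have "g ` ?S = Gamma q n emb y"
  proof (intro equalityI subsetI)
    fix \<sigma> assume "\<sigma> \<in> g ` ?S"
    then obtain \<tau> \<delta> where s: "addtr q n \<delta> = s_n2 q n \<tau>" "\<sigma> = g (\<tau>, \<delta>)"
      by auto
    then show "\<sigma> \<in> Gamma q n emb y"
      unfolding Gamma_def s(2) using g[OF s(1)] s(1) by blast
  next
    fix \<sigma> assume "\<sigma> \<in> Gamma q n emb y"
    then obtain \<tau> \<delta> where s: "addtr q n \<delta> = s_n2 q n \<tau>" "is_sigma q n emb y \<tau> \<delta> \<sigma>"
      unfolding Gamma_def by blast
    then have "\<sigma> = g (\<tau>, \<delta>)"
      using is_sigma_unique g[OF s(1)] by simp
    then show "\<sigma> \<in> g ` ?S"
      using s(1) by blast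
  qed
  ultimately show ?thesis
    using card_image[of g ?S] card_addtr_eq_s_n2[OF additive_power_K q_gt_1 _ K] n by simp
qed


section \<open>Places over the pole of \<open>x\<close>\<close>

lemma place_ring:
  assumes "is_place (C :: 'f::field set) P"
  shows "valuation_ring C (val_ring P)" "vring (val_ring P)" "P = vring.max_ideal (val_ring P)"
proof -
  obtain R where R: "valuation_ring C R" "P = {z \<in> R. z = 0 \<or> inverse z \<notin> R}"
    using assms unfolding is_place_def by blast
  interpret vring R
    using R(1) by unfold_locales (auto simp: valuation_ring_def subring_def)
  have P: "P = max_ideal"
    by (simp add: R(2) max_ideal_def)
  show "valuation_ring C (val_ring P)" "vring (val_ring P)" "P = vring.max_ideal (val_ring P)"
    using R(1) vring_axioms by (simp_all add: P val_ring_max_ideal)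
qed

lemma varF_nonconst: "varF \<noteq> constF (c :: 'k)"
  by (simp add: varF_def constF_def eq_fract)

lemma varF_nonzero: "(varF :: 'k poly fract) \<noteq> 0"
  using varF_nonconst[of 0] by (simp add: constF.hom_zero)

lemma X_nonconst: "X \<noteq> const c"
  by (simp add: emb.hom_eq_iff varF_nonconst)

lemma inverse_varF_nonconst: "inverse varF \<noteq> constF (c :: 'k)"
proof
  assume "inverse varF = constF c"
  then have "varF = constF (inverse c)"
    using constF.hom_inverse[of c] by (metis inverse_inverse_eq)
  then show False
    using varF_nonconst by blast
qed

abbreviation over_pole :: "'e set \<Rightarrow> bool" where
  "over_pole P \<equiv> \<exists>Q. is_place (range constF) Q \<and> varF \<notin> val_ring Q \<and> lies_over emb P Q"

text \<open>Contracting the valuation ring along \<open>emb\<close> yields the place of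
  \<open>K(x)\<close> below \<open>P\<close>, so lying over the pole becomes a condition on
  \<open>X\<close> in \<open>E\<close> alone.\<close>

lemma over_pole_iff:
  assumes P: "is_place (KE emb) P"
  shows "over_pole P \<longleftrightarrow> X \<notin> val_ring P"
proof
  assume "over_pole P"
  then obtain Q where Q: "varF \<notin> val_ring Q" "lies_over emb P Q"
    by blast
  then have "emb (inverse varF) \<in> P"
    by (auto simp: val_ring_def lies_over_def)
  then show "X \<notin> val_ring P"
    by (simp add: val_ring_def emb.hom_inverse emb.hom_eq_0_iff varF_nonzero)
next
  assume X: "X \<notin> val_ring P"
  define R where "R = val_ring P"
  interpret vring R
    unfolding R_def by (rule place_ring(2)[OF P])
  have PR: "P = max_ideal"
    unfolding R_def by (rule place_ring(3)[OF P])
  have KR: "KE emb \<subseteq> R"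
    using place_ring(1)[OF P] by (auto simp: valuation_ring_def R_def)
  have iX: "inverse varF \<in> emb -` R"
    using inverse_in[of X] X by (simp add: R_def emb.hom_inverse)
  have "valuation_ring (range constF) (emb -` R)"
    unfolding valuation_ring_def
  proof (intro conjI ballI allI impI)
    have "range constF \<subseteq> emb -` R"
      using KR by (auto simp: KE_def)
    \<comment> \<open>A valuation ring has to contain the constants properly;
      \<open>inverse varF\<close> is the extra element.\<close>
    moreover have "range constF \<noteq> emb -` R"
      using iX inverse_varF_nonconst by blast
    ultimately show "range constF \<subset> emb -` R"
      by blast
    show "emb -` R \<subset> UNIV"
      using X by (auto simp: R_def)
  qed (use closed inverse_in in \<open>auto simp: emb.hom_zero emb_one emb_add emb.hom_diff emb_mult emb.hom_inverse\<close>)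
  moreover have Q: "emb -` P = {z \<in> emb -` R. z = 0 \<or> inverse z \<notin> emb -` R}"
    by (auto simp: PR max_ideal_def emb.hom_inverse emb.hom_eq_0_iff)
  ultimately have "is_place (range constF) (emb -` P)"
    unfolding is_place_def by blast
  moreover have "varF \<notin> val_ring (emb -` P)"
    using X by (simp add: val_ring_def emb.hom_inverse emb.hom_eq_0_iff)
  moreover have "lies_over emb P (emb -` P)"
    by (auto simp: lies_over_def)
  ultimately show "over_pole P"
    by blast
qed

lemma ex1_over_pole: "\<exists>!P. is_place (KE emb) P \<and> over_pole P"
proof -
  obtain R where R: "pole_ring R"
    using exists_pole_ring ..
  interpret vring R
    using R by (simp add: pole_ring_def)
  have XR: "X \<notin> R" and KR: "KE emb \<subseteq> R"
    using R by (simp_all add: pole_ring_def)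
  have "inverse X \<in> R" "inverse X \<notin> KE emb"
    using inverse_in[OF XR] inverse_varF_nonconst
    by (auto simp: KE_def emb.hom_eq_iff simp flip: emb.hom_inverse)
  then have "KE emb \<subset> R" "R \<subset> UNIV"
    using XR KR by blast+
  then have "valuation_ring (KE emb) R"
    using subring inverse_in unfolding valuation_ring_def subring_def by simp
  then have P: "is_place (KE emb) max_ideal"
    unfolding is_place_def max_ideal_def by (intro exI[of _ R] conjI refl)
  show ?thesis
  proof (rule ex1I)
    show "is_place (KE emb) max_ideal \<and> over_pole max_ideal"
      using P over_pole_iff[OF P] XR by (simp add: val_ring_max_ideal)
    fix P' assume P': "is_place (KE emb) P' \<and> over_pole P'"
    then have P'1: "is_place (KE emb) P'" and "X \<notin> val_ring P'"
      using over_pole_iff by blast+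
    then have "pole_ring (val_ring P')"
      using place_ring[OF P'1] by (auto simp: pole_ring_def valuation_ring_def)
    then have "val_ring P' = R"
      using pole_ring_unique R by blast
    then show "P' = max_ideal"
      using place_ring(3)[OF P'1] by simp
  qed
qed


section \<open>Affine points\<close>

definition point_ring :: "'k \<Rightarrow> 'k \<Rightarrow> 'e set \<Rightarrow> bool" where
  "point_ring a b R \<longleftrightarrow> vring R \<and> KE emb \<subseteq> R \<and>
     X - const a \<in> vring.max_ideal R \<and> y - const b \<in> vring.max_ideal R"

text \<open>The coordinate ring \<open>K[x, y]\<close> of the affine curve, with induction over its
  construction in place of polynomials in two variables.\<close>

inductive_set A :: "'e set" where
  const: "const c \<in> A"
| X: "X \<in> A"
| y: "y \<in> A"
| add: "f \<in> A \<Longrightarrow> g \<in> A \<Longrightarrow> f + g \<in> A"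
| mult: "f \<in> A \<Longrightarrow> g \<in> A \<Longrightarrow> f * g \<in> A"

lemma subring_A: "subring A"
proof -
  have "f - g \<in> A" if "f \<in> A" "g \<in> A" for f g
  proof -
    have "f + const (- 1) * g \<in> A"
      using that A.intros by blast
    then show ?thesis
      by (simp add: const.hom_uminus const.hom_one)
  qed
  then show ?thesis
    using A.const[of 0] A.const[of 1] A.add A.mult
    by (auto simp: subring_def const.hom_zero const.hom_one)
qed

lemmas A_closed = subringD[OF subring_A] subring_power[OF subring_A] subring_sum[OF subring_A]

text \<open>First-order expansion at the point \<open>(a, b)\<close>: what remains of
  \<open>f\<close> after its constant term lies in the ideal generated by \<open>X - const a\<close>
  and \<open>y - const b\<close>.\<close>

lemma A_decomp:
  assumes "f \<in> A"
  shows "\<exists>c. \<exists>\<alpha>\<in>A. \<exists>\<beta>\<in>A. f = const c + (X - const a) * \<alpha> + (y - const b) * \<beta>"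
  using assms
proof induction
  case (const c)
  have "const c = const c + (X - const a) * 0 + (y - const b) * 0"
    by simp
  then show ?case
    using A_closed(1) by blast
next
  case X
  have "X = const a + (X - const a) * 1 + (y - const b) * 0"
    by simp
  then show ?case
    using A_closed(1,2) by blast
next
  case y
  have "y = const b + (X - const a) * 0 + (y - const b) * 1"
    by simp
  then show ?case
    using A_closed(1,2) by blast
next
  case (add f g)
  then obtain c \<alpha> \<beta> c' \<alpha>' \<beta>' where AA: "\<alpha> \<in> A" "\<beta> \<in> A" "\<alpha>' \<in> A" "\<beta>' \<in> A"
    and f: "f = const c + (X - const a) * \<alpha> + (y - const b) * \<beta>"
    and g: "g = const c' + (X - const a) * \<alpha>' + (y - const b) * \<beta>'"
    by blast
  have "f + g = const (c + c') + (X - const a) * (\<alpha> + \<alpha>') + (y - const b) * (\<beta> + \<beta>')"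
    unfolding f g const.hom_add by (simp add: algebra_simps)
  then show ?case
    using AA A_closed(3) by blast
next
  case (mult f g)
  then obtain c \<alpha> \<beta> c' \<alpha>' \<beta>' where AA: "\<alpha> \<in> A" "\<beta> \<in> A" "\<alpha>' \<in> A" "\<beta>' \<in> A"
    and f: "f = const c + (X - const a) * \<alpha> + (y - const b) * \<beta>"
    and g: "g = const c' + (X - const a) * \<alpha>' + (y - const b) * \<beta>'"
    by blast
  have "f * g = const c * g + (X - const a) * (\<alpha> * g) + (y - const b) * (\<beta> * g)"
    by (simp add: f algebra_simps)
  also have "const c * g = const (c * c') + (X - const a) * (const c * \<alpha>') + (y - const b) * (const c * \<beta>')"
    unfolding g const.hom_mult by (simp add: algebra_simps)
  finally have "f * g = const (c * c') + (X - const a) * (const c * \<alpha>' + \<alpha> * g) + (y - const b) * (const c * \<beta>' + \<beta> * g)"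
    by (simp add: algebra_simps)
  moreover have "const c * \<alpha>' + \<alpha> * g \<in> A" "const c * \<beta>' + \<beta> * g \<in> A"
    by (intro A.add A.mult A.const AA mult.hyps)+
  ultimately show ?case
    by blast
qed

lemma A_subset:
  assumes "point_ring a b R"
  shows "A \<subseteq> R"
proof
  interpret vring R
    using assms by (simp add: point_ring_def)
  fix f assume "f \<in> A"
  then show "f \<in> R"
  proof induction
    case (const c)
    then show ?case
      using assms const_in_KE by (auto simp: point_ring_def)
  next
    case X
    have "(X - const a) + const a \<in> R"
      using assms const_in_KE[of a] by (intro closed(3)[OF max_ideal_subset]) (auto simp: point_ring_def)
    then show ?case by simp
  next
    case y
    have "(y - const b) + const b \<in> R"
      using assms const_in_KE[of b] by (intro closed(3)[OF max_ideal_subset]) (auto simp: point_ring_def)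
    then show ?case by simp
  qed (auto intro: closed)
qed

lemma unit_of_value:
  assumes R: "point_ring a b R" and c: "c \<noteq> 0" and A: "\<alpha> \<in> A" "\<beta> \<in> A"
  shows "vring.unit R (const c + (X - const a) * \<alpha> + (y - const b) * \<beta>)"
proof -
  interpret vring R
    using R by (simp add: point_ring_def)
  have "(X - const a) * \<alpha> \<in> max_ideal" "(y - const b) * \<beta> \<in> max_ideal"
    using max_ideal_mult[of \<alpha> "X - const a"] max_ideal_mult[of \<beta> "y - const b"] A A_subset[OF R] R
    by (auto simp: point_ring_def mult.commute)
  then show ?thesis
    using unit_const[OF vring_axioms _ c] R unit_add_max_ideal by (simp add: point_ring_def)
qed

text \<open>The curve is smooth at the affine points: \<open>x - a\<close> generates the maximal ideal of the local ring,
  because \<open>y - b\<close> divides \<open>Tr (y - b)\<close> with a quotient congruent to \<open>1\<close>.\<close>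

lemma y_multiple_of_X:
  assumes ab: "addtr q n b = s_n2 q n a"
  shows "\<exists>w\<in>A. \<exists>h\<in>A. (y - const b) * w = (X - const a) * h \<and> (\<forall>R. point_ring a b R \<longrightarrow> vring.unit R w)"
proof -
  let ?\<pi> = "X - const a" and ?\<eta> = "y - const b"
  have \<pi>A: "?\<pi> \<in> A" and \<eta>A: "?\<eta> \<in> A"
    using A.const A.X A.y A_closed(4) by blast+
  have dec: "z ^ m = z * z ^ (m - 1)" if "m > 0" for z :: 'e and m
    using that by (cases m) auto
  have pos: "q ^ i > 0" for i
    using q_gt_1 by simp
  \<comment> \<open>\<open>w\<close> is the quotient of \<open>addtr q n ?\<eta>\<close> by
    \<open>?\<eta>\<close>, and \<open>h\<close> that of the right-hand side by
    \<open>?\<pi>\<close>, once the equation is moved to the point \<open>(a, b)\<close> by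
    \<open>s_n2_add\<close>.\<close>
  define w where "w = (\<Sum>i<n. ?\<eta> ^ (q ^ i - 1))"
  define h where "h = (\<Sum>k<n. \<Sum>j<k. ?\<pi> ^ (q ^ j + q ^ k - 1))
      + (\<Sum>i<n. ?\<pi> ^ (q ^ i - 1) * const (T a) ^ (q ^ i))"
  have "?\<eta> * w = addtr q n ?\<eta>"
    unfolding w_def addtr_def sum_distrib_left by (intro sum.cong refl dec[symmetric] pos)
  also have "\<dots> = s_n2 q n X - const (s_n2 q n a)"
    using eqn ab by (simp add: E.addtr_diff emb.hom_s_n2 flip: const.hom_addtr)
  also have "s_n2 q n X = s_n2 q n ?\<pi> + const (s_n2 q n a) + addtr q n (?\<pi> * const (T a))"
    using E.s_n2_add[of n "const a" ?\<pi>] n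
    by (simp add: const.hom_s_n2 const.hom_sum const.hom_power power_qn flip: const.hom_power)
  also have "s_n2 q n ?\<pi> + const (s_n2 q n a) + addtr q n (?\<pi> * const (T a)) - const (s_n2 q n a)
      = s_n2 q n ?\<pi> + addtr q n (?\<pi> * const (T a))"
    by simp
  also have "s_n2 q n ?\<pi> = ?\<pi> * (\<Sum>k<n. \<Sum>j<k. ?\<pi> ^ (q ^ j + q ^ k - 1))"
    unfolding s_n2_def sum_distrib_left by (intro sum.cong refl dec) (use pos in simp)
  also have "addtr q n (?\<pi> * const (T a)) = ?\<pi> * (\<Sum>i<n. ?\<pi> ^ (q ^ i - 1) * const (T a) ^ (q ^ i))"
    unfolding addtr_def sum_distrib_left power_mult_distrib mult.assoc[symmetric]
    by (intro sum.cong refl arg_cong2[where f = "(*)"] dec pos)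
  finally have eq: "?\<eta> * w = ?\<pi> * h"
    by (simp add: h_def distrib_left)
  have wA: "w \<in> A"
    unfolding w_def by (intro A_closed(6,7) \<eta>A)
  have hA: "h \<in> A"
    unfolding h_def by (intro A_closed(3,5,6,7) \<pi>A A.const)
  have "vring.unit R w" if R: "point_ring a b R" for R
  proof -
    \<comment> \<open>The term of \<open>w\<close> for \<open>i = 0\<close> is \<open>1\<close>; the
      others are divisible by \<open>?\<eta>\<close>, and \<open>q ^ Suc i \<ge> 2\<close> keeps the
      truncated subtraction exact.\<close>
    define g where "g = (\<Sum>i<n - 1. ?\<eta> ^ (q ^ Suc i - 2))"
    have "w = (\<Sum>i<Suc (n - 1). ?\<eta> ^ (q ^ i - 1))"
      using n by (simp add: w_def)
    also have "\<dots> = 1 + (\<Sum>i<n - 1. ?\<eta> ^ (q ^ Suc i - 1))"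
      by (subst sum.lessThan_Suc_shift) simp
    also have "(\<Sum>i<n - 1. ?\<eta> ^ (q ^ Suc i - 1)) = ?\<eta> * g"
      unfolding g_def sum_distrib_left
    proof (intro sum.cong refl)
      fix i
      have "1 < q ^ Suc i"
        using q_gt_1 by (rule one_less_power) simp
      then show "?\<eta> ^ (q ^ Suc i - 1) = ?\<eta> * ?\<eta> ^ (q ^ Suc i - 2)"
        using dec[of "q ^ Suc i - 1" ?\<eta>] by (simp add: numeral_2_eq_2)
    qed
    finally have "w = const 1 + ?\<pi> * 0 + ?\<eta> * g"
      by (simp add: const.hom_one)
    moreover have "g \<in> A"
      unfolding g_def by (intro A_closed(6,7) \<eta>A)
    ultimately show ?thesis
      using unit_of_value[OF R, of 1 0 g] A_closed(1) by simp
  qed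
  then show ?thesis
    using eq wA hA by blast
qed

section \<open>Factorisation in the local ring of an affine point\<close>

lemma emb_poly_in_A: "emb (Fract p 1) \<in> A"
proof (induction p)
  case 0
  show ?case
    using A_closed(1) by (simp add: fract_collapse emb.hom_zero)
next
  case (pCons a p)
  then show ?case
    unfolding fract_poly_pCons emb_add emb_mult by (intro A.intros)
qed

lemma clear_denominators: "\<exists>p. p \<noteq> 0 \<and> emb (Fract p 1) * emb.hom_poly y r \<in> A"
proof (induction r)
  case 0
  show ?case
    using A_closed(1) by (intro exI[of _ 1]) simp
next
  case (pCons c r)
  then obtain p where p: "p \<noteq> 0" "emb (Fract p 1) * emb.hom_poly y r \<in> A"
    by blast
  obtain u v where c: "c = Fract u v" "v \<noteq> 0"
    by (cases c) auto
  have "Fract v 1 * c = Fract u 1"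
    using c by (simp add: eq_fract)
  then have vc: "emb (Fract v 1) * emb c = emb (Fract u 1)"
    by (simp flip: emb_mult)
  have "emb (Fract (v * p) 1) = emb (Fract v 1) * emb (Fract p 1)"
    by (simp flip: emb_mult)
  then have "emb (Fract (v * p) 1) * emb.hom_poly y (pCons c r)
      = emb (Fract p 1) * (emb (Fract v 1) * emb c) + y * emb (Fract v 1) * (emb (Fract p 1) * emb.hom_poly y r)"
    by (simp add: algebra_simps)
  also have "\<dots> \<in> A"
    unfolding vc by (intro A.add A.mult A.y emb_poly_in_A p(2))
  finally show ?case
    using p(1) c(2) by (intro exI[of _ "v * p"]) simp
qed

text \<open>A substitute for the norm: \<open>inverse f\<close> is a polynomial in \<open>y\<close>
  over \<open>K(x)\<close>, and clearing its denominators shows that \<open>f\<close> divides a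
  nonzero polynomial in \<open>x\<close>. This bounds how often \<open>X - const a\<close> can be
  split off from \<open>f\<close>.\<close>

lemma A_multiple_poly:
  assumes "f \<in> A" "f \<noteq> 0"
  shows "\<exists>p g. p \<noteq> 0 \<and> g \<in> A \<and> f * g = emb (Fract p 1)"
proof -
  obtain r where r: "inverse f = emb.hom_poly y r"
    using range_hom_poly_y by (metis UNIV_I imageE)
  obtain p where p: "p \<noteq> 0" "emb (Fract p 1) * inverse f \<in> A"
    unfolding r using clear_denominators by blast
  have "f * (emb (Fract p 1) * inverse f) = emb (Fract p 1)"
    using assms by simp
  then show ?thesis
    using p by blast
qed

text \<open>Otherwise \<open>X - const a\<close> could be split off without end, whereas
  \<open>f\<close> divides a polynomial in \<open>x\<close> with a zero of finite order at
  \<open>a\<close>. The factors are units in all rings at the point simultaneously, which is what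
  allows two such rings to be compared.\<close>

lemma A_factor:
  assumes ab: "addtr q n b = s_n2 q n a" and R: "point_ring a b R"
    and f: "f \<in> A" "f \<noteq> 0"
  shows "\<exists>k w u. w * f = (X - const a) ^ k * u \<and>
    (\<forall>R. point_ring a b R \<longrightarrow> vring.unit R w \<and> vring.unit R u)"
proof (rule ccontr)
  let ?\<pi> = "X - const a" and ?\<eta> = "y - const b"
  let ?reg = "\<lambda>u. \<forall>R. point_ring a b R \<longrightarrow> vring.unit R u"
  assume no: "\<not> ?thesis"
  interpret vring R
    using R by (simp add: point_ring_def)
  obtain w0 h where w0: "w0 \<in> A" "h \<in> A" "?\<eta> * w0 = ?\<pi> * h" "?reg w0"
    using y_multiple_of_X[OF ab] by blast
  have unit_mult': "vring.unit S (u * v)" if "point_ring a b S" "vring.unit S u" "vring.unit S v" for S u v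
    using that vring.unit_mult[of S u v] by (simp add: point_ring_def)
  have step: "\<exists>w g. ?reg w \<and> g \<in> A \<and> w * f = ?\<pi> ^ k * g" for k
  proof (induction k)
    case 0
    have "?reg 1"
      by (simp add: point_ring_def vring.unit_1)
    then show ?case
      using f(1) by (intro exI[of _ 1] exI[of _ f]) simp
  next
    case (Suc k)
    then obtain w g where w: "?reg w" "g \<in> A" "w * f = ?\<pi> ^ k * g"
      by blast
    obtain c \<alpha> \<beta> where g: "\<alpha> \<in> A" "\<beta> \<in> A" "g = const c + ?\<pi> * \<alpha> + ?\<eta> * \<beta>"
      using A_decomp[OF w(2)] by blast
    \<comment> \<open>With a nonzero value at the point, \<open>g\<close> would be a unit in every
      ring there and the factorisation would be complete, against \<open>no\<close>. With value
      zero, multiplication by \<open>w0\<close> converts the \<open>?\<eta>\<close> part into a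
      multiple of \<open>?\<pi>\<close>.\<close>
    have "c = 0"
    proof (rule ccontr)
      assume "c \<noteq> 0"
      then have "?reg g"
        using unit_of_value g by blast
      then show False
        using no w by blast
    qed
    then have g': "g = ?\<pi> * \<alpha> + ?\<eta> * \<beta>"
      using g by (simp add: const.hom_zero)
    have "w0 * g = w0 * (?\<pi> * \<alpha>) + (?\<eta> * w0) * \<beta>"
      unfolding g' by (simp add: algebra_simps)
    also have "\<dots> = ?\<pi> * (w0 * \<alpha> + h * \<beta>)"
      unfolding w0(3) by (simp add: algebra_simps)
    finally have w0g: "w0 * g = ?\<pi> * (w0 * \<alpha> + h * \<beta>)" .
    have "w0 * w * f = ?\<pi> ^ k * (w0 * g)"
      by (simp only: mult.assoc w(3) mult.left_commute)
    also have "\<dots> = ?\<pi> ^ Suc k * (w0 * \<alpha> + h * \<beta>)"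
      by (simp only: w0g power_Suc2 mult.assoc)
    finally have "w0 * w * f = ?\<pi> ^ Suc k * (w0 * \<alpha> + h * \<beta>)" .
    moreover have "?reg (w0 * w)"
      using w0(4) w(1) unit_mult' by blast
    moreover have "w0 * \<alpha> + h * \<beta> \<in> A"
      using w0 g by (intro A.add A.mult)
    ultimately show ?case
      by blast
  qed
  obtain p g where p: "p \<noteq> 0" "g \<in> A" "f * g = emb (Fract p 1)"
    using A_multiple_poly[OF f] by blast
  define r where "r = order a p"
  obtain p1 where p1: "p = [:- a, 1:] ^ r * p1" "\<not> [:- a, 1:] dvd p1"
    using order_decomp[OF p(1), of a] unfolding r_def by blast
  have \<pi>: "?\<pi> = emb (Fract [:- a, 1:] 1)"
    by (simp add: varF_def constF_def flip: emb.hom_diff)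
  have embp_mult: "emb (Fract (u * v) 1) = emb (Fract u 1) * emb (Fract v 1)" for u v
    by (simp flip: emb_mult)
  have embp_power: "emb (Fract (u ^ m) 1) = emb (Fract u 1) ^ m" for u m
    by (induction m) (simp_all only: power_0 power_Suc embp_mult emb_one flip: One_fract_def)
  have u1: "unit (emb (Fract p1 1))"
  proof -
    obtain s where s: "p1 - [:poly p1 a:] = [:- a, 1:] * s"
      using poly_eq_0_iff_dvd[of "p1 - [:poly p1 a:]" a] by (auto elim: dvdE)
    then have "p1 = [:poly p1 a:] + [:- a, 1:] * s"
      by (simp add: algebra_simps)
    then have "Fract p1 1 = Fract [:poly p1 a:] 1 + Fract ([:- a, 1:] * s) 1"
      by (metis add_fract mult.right_neutral one_neq_zero)
    then have "emb (Fract p1 1) = const (poly p1 a) + ?\<pi> * emb (Fract s 1) + ?\<eta> * 0"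
      by (simp only: emb_add embp_mult \<pi> mult_zero_right add_0_right flip: constF_def)
    moreover have "poly p1 a \<noteq> 0"
      using p1(2) by (simp add: poly_eq_0_iff_dvd)
    ultimately show ?thesis
      using unit_of_value[OF R _ emb_poly_in_A A_closed(1)] by simp
  qed
  \<comment> \<open>One division more than the multiplicity \<open>r\<close> of \<open>a\<close> as
    a root of \<open>p\<close>: after cancelling \<open>?\<pi> ^ r\<close>, a unit would equal a
    multiple of \<open>?\<pi>\<close>.\<close>
  obtain w f' where w: "?reg w" "f' \<in> A" "w * f = ?\<pi> ^ Suc r * f'"
    using step by blast
  have "w * (?\<pi> ^ r * emb (Fract p1 1)) = w * f * g"
    using p(3) p1(1) by (simp add: embp_mult embp_power \<pi> mult.assoc)
  also have "\<dots> = ?\<pi> ^ r * (?\<pi> * (f' * g))"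
    using w(3) by (simp add: mult_ac)
  finally have "?\<pi> ^ r * (w * emb (Fract p1 1)) = ?\<pi> ^ r * (?\<pi> * (f' * g))"
    by (simp only: mult.left_commute)
  then have "w * emb (Fract p1 1) = (f' * g) * ?\<pi>"
    using X_nonconst[of a] by (simp add: mult.commute)
  moreover have "(f' * g) * ?\<pi> \<in> max_ideal"
    using A_subset[OF R] w(2) p(2) R by (intro max_ideal_mult closed) (auto simp: point_ring_def)
  moreover have "unit (w * emb (Fract p1 1))"
    using unit_mult w(1) u1 R by blast
  ultimately show False
    using unit_or_max_ideal max_ideal_subset by metis
qed

lemma quotient_of_A: "\<exists>f\<in>A. \<exists>g\<in>A. g \<noteq> 0 \<and> z = f * inverse g"
proof -
  define L where "L = {z. \<exists>f\<in>A. \<exists>g\<in>A. g \<noteq> 0 \<and> z = f * inverse g}"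
  have mem: "z \<in> L" if "f \<in> A" "g \<in> A" "g \<noteq> 0" "z = f * inverse g" for z f g
    using that by (auto simp: L_def)
  have "L = UNIV"
  proof (rule gen)
    show "y \<in> L"
      using mem[OF A.y A_closed(2)] by simp
    show "range emb \<subseteq> L"
    proof
      fix z assume "z \<in> range emb"
      then obtain c where z: "z = emb c" by blast
      obtain u v where c: "c = Fract u v" "v \<noteq> 0"
        by (cases c) auto
      then have "c = Fract u 1 * inverse (Fract v 1)"
        by simp
      then have "z = emb (Fract u 1) * inverse (emb (Fract v 1))"
        unfolding z by (simp only: emb_mult emb.hom_inverse)
      moreover have "emb (Fract v 1) \<noteq> 0"
        using c(2) by (simp add: emb.hom_eq_0_iff Zero_fract_def eq_fract)
      ultimately show "z \<in> L"
        using mem[OF emb_poly_in_A emb_poly_in_A] by blast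
    qed
    show "is_subfield L"
      unfolding is_subfield_def
    proof (intro conjI ballI)
      show "0 \<in> L" "1 \<in> L"
        using mem[OF A_closed(1,2)] mem[OF A_closed(2,2)] by simp_all
      fix u assume "u \<in> L"
      then obtain f g where u: "f \<in> A" "g \<in> A" "g \<noteq> 0" "u = f * inverse g"
        unfolding L_def by blast
      show "inverse u \<in> L"
      proof (cases "f = 0")
        case True
        then show ?thesis
          using \<open>0 \<in> L\<close> u by simp
      next
        case False
        then show ?thesis
          using mem[OF u(2,1)] u(4) by (simp add: mult.commute)
      qed
      fix v assume "v \<in> L"
      then obtain f' g' where v: "f' \<in> A" "g' \<in> A" "g' \<noteq> 0" "v = f' * inverse g'"
        unfolding L_def by blast
      have gg: "g * g' \<in> A" "g * g' \<noteq> 0"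
        using u v A.mult by auto
      show "u + v \<in> L"
        by (rule mem[of "f * g' + f' * g", OF _ gg]) (use u v A.add A.mult in \<open>auto simp: field_simps\<close>)
      show "u - v \<in> L"
        by (rule mem[of "f * g' - f' * g", OF _ gg]) (use u v A_closed(4) A.mult in \<open>auto simp: field_simps\<close>)
      show "u * v \<in> L"
        by (rule mem[of "f * f'", OF _ gg]) (use u v A.mult in \<open>auto simp: field_simps\<close>)
    qed
  qed
  then show ?thesis
    unfolding L_def by blast
qed

text \<open>Up to a common unit of both rings, \<open>z\<close> is an integral power of
  \<open>X - const a\<close>. Membership in \<open>R\<close> makes the exponent nonnegative, and
  this does not depend on the ring.\<close>

lemma point_ring_subset:
  assumes ab: "addtr q n b = s_n2 q n a" and R: "point_ring a b R" and R': "point_ring a b R'"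
  shows "R \<subseteq> R'"
proof
  let ?\<pi> = "X - const a"
  interpret R: vring R
    using R by (simp add: point_ring_def)
  interpret R': vring R'
    using R' by (simp add: point_ring_def)
  fix z assume z: "z \<in> R"
  show "z \<in> R'"
  proof (cases "z = 0")
    case True
    then show ?thesis
      using R'.closed(1) by simp
  next
    case False
    obtain f g where fg: "f \<in> A" "g \<in> A" "g \<noteq> 0" "z = f * inverse g"
      using quotient_of_A by blast
    then have "f \<noteq> 0"
      using False by auto
    then obtain k w u where f: "w * f = ?\<pi> ^ k * u" "\<And>S. point_ring a b S \<Longrightarrow> vring.unit S w \<and> vring.unit S u"
      using A_factor[OF ab R fg(1)] by blast
    obtain l w' u' where g: "w' * g = ?\<pi> ^ l * u'" "\<And>S. point_ring a b S \<Longrightarrow> vring.unit S w' \<and> vring.unit S u'"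
      using A_factor[OF ab R fg(2,3)] by blast
    have nz: "w \<noteq> 0" "u \<noteq> 0" "w' \<noteq> 0" "u' \<noteq> 0" "?\<pi> \<noteq> 0"
      using f(2)[OF R] g(2)[OF R] X_nonconst[of a] by (auto simp: R.unit_def)
    define e where "e = u * w' * inverse (w * u')"
    have e: "R.unit e" "R'.unit e"
      unfolding e_def using f(2)[OF R] g(2)[OF R] f(2)[OF R'] g(2)[OF R']
      by (blast intro: R.unit_mult R.unit_inverse R'.unit_mult R'.unit_inverse)+
    have f': "f = ?\<pi> ^ k * u * inverse w" and g': "g = ?\<pi> ^ l * u' * inverse w'"
      using f(1) g(1) nz by (simp_all add: field_simps)
    have zl: "z * ?\<pi> ^ l = ?\<pi> ^ k * e"
      unfolding fg(4) e_def f' g' using nz by (simp add: field_simps)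
    have "l \<le> k"
    proof (rule ccontr)
      assume "\<not> l \<le> k"
      then obtain m where "l = k + Suc m"
        using less_imp_Suc_add[of k l] by auto
      then have "?\<pi> ^ k * (z * ?\<pi> ^ m * ?\<pi>) = ?\<pi> ^ k * e"
        using zl by (simp add: power_add mult_ac)
      then have "e = z * ?\<pi> ^ m * ?\<pi>"
        using nz(5) by simp
      also have "\<dots> \<in> R.max_ideal"
        using R by (intro R.max_ideal_mult R.closed(5) z R.closed(7) R.max_ideal_subset) (simp_all add: point_ring_def)
      finally show False
        using e(1) R.unit_or_max_ideal R.max_ideal_subset by blast
    qed
    then have "?\<pi> ^ k = ?\<pi> ^ l * ?\<pi> ^ (k - l)"
      by (simp flip: power_add)
    then have "?\<pi> ^ l * z = ?\<pi> ^ l * (?\<pi> ^ (k - l) * e)"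
      using zl by (simp add: mult_ac)
    then have "z = ?\<pi> ^ (k - l) * e"
      using nz(5) by simp
    also have "\<dots> \<in> R'"
      using R' R'.max_ideal_subset e(2) by (intro R'.closed(5,7)) (auto simp: point_ring_def R'.unit_def)
    finally show ?thesis .
  qed
qed

section \<open>Places of degree one as points, and transitivity\<close>

lemma addtr_max_ideal:
  assumes "vring R" "z \<in> vring.max_ideal R"
  shows "addtr q n z \<in> vring.max_ideal R" "s_n2 q n z \<in> vring.max_ideal R"
proof -
  interpret vring R by fact
  have pow: "z ^ m \<in> max_ideal" if "m > 0" for m
    using that max_ideal_mult[of "z ^ (m - 1)" z] closed(7)[OF max_ideal_subset[OF assms(2)]] assms(2)
    by (cases m) (auto simp: mult.commute)
  show "addtr q n z \<in> max_ideal" "s_n2 q n z \<in> max_ideal"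
    unfolding addtr_def s_n2_def using q_gt_1 by (auto intro!: max_ideal_sum pow)
qed

lemma y_integral:
  assumes "vring R" "X \<in> R"
  shows "y \<in> R"
proof (rule ccontr)
  interpret vring R by fact
  assume y: "y \<notin> R"
  then have w: "inverse y \<in> R"
    by (rule inverse_in)
  have y0: "y \<noteq> 0"
    using y closed by auto
  have Npos: "N > 0"
    using q_gt_1 by simp
  have red: "y ^ (q ^ i) * inverse y ^ (N - 1) \<in> R" if "i < n - 1" for i
  proof -
    have "q ^ i < N"
      using that q_gt_1 by (intro power_strict_increasing) auto
    then have "N - 1 = q ^ i + (N - 1 - q ^ i)"
      by simp
    then have "inverse y ^ (N - 1) = inverse y ^ (q ^ i) * inverse y ^ (N - 1 - q ^ i)"
      by (metis power_add)
    then have "y ^ (q ^ i) * inverse y ^ (N - 1) = inverse y ^ (N - 1 - q ^ i)"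
      using power_mult_inverse_power[OF y0, of "q ^ i"] by (simp only: mult.assoc[symmetric] mult_1_left)
    then show ?thesis
      using w closed by simp
  qed
  have "y ^ N = y * y ^ (N - 1)"
    using Npos by (metis Suc_diff_1 power_Suc)
  then have "y ^ N * inverse y ^ (N - 1) = y"
    using power_mult_inverse_power[OF y0, of "N - 1"] by (simp only: mult.assoc mult_1_right)
  moreover have "addtr q n y = (\<Sum>i<n - 1. y ^ (q ^ i)) + y ^ N"
    using sum.lessThan_Suc[of "\<lambda>i. y ^ (q ^ i)" "n - 1"] n by (simp add: addtr_def)
  \<comment> \<open>The integral equation of \<open>y\<close> divided by \<open>y ^ (N - 1)\<close>:
    if \<open>y\<close> were not in \<open>R\<close>, everything on the right would still be, since
    the lower powers of \<open>y\<close> have become powers of \<open>inverse y\<close>.\<close>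
  ultimately have "y = addtr q n y * inverse y ^ (N - 1) - (\<Sum>i<n - 1. y ^ (q ^ i) * inverse y ^ (N - 1))"
    by (simp only: distrib_right sum_distrib_right) simp
  moreover have "addtr q n y \<in> R"
    unfolding eqn unfolding emb.hom_s_n2 unfolding s_n2_def by (intro closed(7,8) assms(2))
  then have "addtr q n y * inverse y ^ (N - 1) - (\<Sum>i<n - 1. y ^ (q ^ i) * inverse y ^ (N - 1)) \<in> R"
    using red by (intro closed(4)[OF closed(5) closed(8)] closed(7)[OF w]) simp_all
  ultimately show False
    using y by simp
qed

text \<open>The values of \<open>x\<close> and \<open>y\<close> in the residue field satisfy the
  equation of the curve, because the difference of its two sides is a constant in the maximal ideal
  and hence zero.\<close>

lemma degree_one_point:
  assumes P: "degree_one (KE emb) P" and X: "\<not> over_pole P"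
  shows "\<exists>a b. addtr q n b = s_n2 q n a \<and> point_ring a b (val_ring P)"
proof -
  have pl: "is_place (KE emb) P"
    using P by (simp add: degree_one_def)
  define R where "R = val_ring P"
  interpret vring R
    unfolding R_def by (rule place_ring(2)[OF pl])
  have PR: "P = max_ideal"
    unfolding R_def by (rule place_ring(3)[OF pl])
  have KR: "KE emb \<subseteq> R"
    using place_ring(1)[OF pl] by (auto simp: valuation_ring_def R_def)
  have XR: "X \<in> R"
    using X over_pole_iff[OF pl] by (simp add: R_def)
  have res: "\<exists>c. z - const c \<in> max_ideal" if "z \<in> R" for z
    using P that by (auto simp: degree_one_def R_def[symmetric] PR[symmetric] KE_def)
  obtain a b where a: "X - const a \<in> max_ideal" and b: "y - const b \<in> max_ideal"
    using res XR y_integral[OF vring_axioms XR] by blast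
  have "s_n2 q n X = s_n2 q n (X - const a) + const (s_n2 q n a) + addtr q n ((X - const a) * const (T a))"
    using E.s_n2_add[of n "const a" "X - const a"] n
    by (simp add: const.hom_s_n2 const.hom_sum const.hom_power power_qn flip: const.hom_power)
  moreover have "addtr q n (y - const b) = s_n2 q n X - const (addtr q n b)"
    using eqn by (simp add: E.addtr_diff emb.hom_s_n2 const.hom_addtr)
  ultimately have "const (addtr q n b - s_n2 q n a)
      = s_n2 q n (X - const a) + addtr q n (const (T a) * (X - const a)) - addtr q n (y - const b)"
    by (simp add: const.hom_diff mult.commute)
  also have "\<dots> \<in> max_ideal"
  proof -
    have "const (T a) \<in> R"
      using const_in_KE KR by blast
    then show ?thesis
      using max_ideal_diff[OF max_ideal_add] addtr_max_ideal[OF vring_axioms] a b max_ideal_mult[OF _ a]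
      by simp
  qed
  finally have "addtr q n b - s_n2 q n a = 0"
    using unit_const[OF vring_axioms KR] unit_or_max_ideal max_ideal_subset by blast
  then have "addtr q n b = s_n2 q n a"
    by simp
  moreover have "point_ring a b R"
    using vring_axioms KR a b by (simp add: point_ring_def)
  ultimately show ?thesis
    unfolding R_def by blast
qed

lemma Gamma_transitive:
  assumes P: "degree_one (KE emb) P" "\<not> over_pole P" and P': "degree_one (KE emb) P'" "\<not> over_pole P'"
  shows "\<exists>\<sigma>\<in>Gamma q n emb y. \<sigma> ` P = P'"
proof -
  obtain a b where ab: "addtr q n b = s_n2 q n a" "point_ring a b (val_ring P)"
    using degree_one_point[OF P] by blast
  obtain a' b' where ab': "addtr q n b' = s_n2 q n a'" "point_ring a' b' (val_ring P')"
    using degree_one_point[OF P'] by blast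
  \<comment> \<open>The parameters are found by requiring that \<sigma> send
    \<open>X - const a\<close> to \<open>X - const a'\<close> and a combination of
    \<open>y - const b\<close> and \<open>X - const a\<close> to \<open>y - const b'\<close>. By the
    addition formula for \<open>s_n2\<close> at \<open>a = a' + \<tau>\<close>, the resulting pair
    is admissible.\<close>
  define \<tau> where "\<tau> = a - a'"
  define \<delta> where "\<delta> = b - b' - a' * T \<tau>"
  have \<delta>: "addtr q n \<delta> = s_n2 q n \<tau>"
    using s_n2_add_K[of a' \<tau>] ab(1) ab'(1) by (simp add: \<delta>_def K.addtr_diff \<tau>_def)
  obtain \<sigma> where \<sigma>: "is_sigma q n emb y \<tau> \<delta> \<sigma>"
    using exists_sigma[OF \<delta>] by blast
  note s = is_sigmaD[OF \<sigma>]
  interpret \<sigma>: field_hom \<sigma>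
    by (rule s(1))
  define R where "R = val_ring P"
  have pl: "is_place (KE emb) P" "is_place (KE emb) P'"
    using P(1) P'(1) by (simp_all add: degree_one_def)
  interpret vring R
    unfolding R_def by (rule place_ring(2)[OF pl(1)])
  have PR: "P = max_ideal"
    unfolding R_def by (rule place_ring(3)[OF pl(1)])
  have KR: "KE emb \<subseteq> R" and aP: "X - const a \<in> max_ideal" and bP: "y - const b \<in> max_ideal"
    using ab(2) by (simp_all add: point_ring_def R_def)
  have mem: "\<sigma> z \<in> \<sigma> ` S \<longleftrightarrow> z \<in> S" for z S
    using s(2) by (simp add: bij_is_inj inj_image_mem_iff)
  have ex: "\<exists>w. z = \<sigma> w" for z
    using s(2) by (metis bij_pointE)
  have vr: "vring (\<sigma> ` R)"
  proof
    show "subring (\<sigma> ` R)"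
      unfolding subring_def
    proof (intro conjI ballI)
      show "0 \<in> \<sigma> ` R" "1 \<in> \<sigma> ` R"
        using mem[of 0 R] mem[of 1 R] closed(1,2) by (simp_all add: \<sigma>.hom_zero \<sigma>.hom_one)
      fix u v assume "u \<in> \<sigma> ` R" "v \<in> \<sigma> ` R"
      then obtain u' v' where "u = \<sigma> u'" "v = \<sigma> v'" "u' \<in> R" "v' \<in> R"
        by blast
      then show "u + v \<in> \<sigma> ` R" "u - v \<in> \<sigma> ` R" "u * v \<in> \<sigma> ` R"
        by (simp_all add: mem closed flip: \<sigma>.hom_add \<sigma>.hom_diff \<sigma>.hom_mult)
    qed
    fix z assume "z \<notin> \<sigma> ` R"
    moreover obtain w where "z = \<sigma> w"
      using ex by blast
    ultimately show "inverse z \<in> \<sigma> ` R"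
      using inverse_in[of w] by (simp add: mem flip: \<sigma>.hom_inverse)
  qed
  have mi: "vring.max_ideal (\<sigma> ` R) = \<sigma> ` P"
  proof (intro set_eqI)
    fix z
    obtain w where "z = \<sigma> w"
      using ex by blast
    then show "z \<in> vring.max_ideal (\<sigma> ` R) \<longleftrightarrow> z \<in> \<sigma> ` P"
      by (simp add: vring.max_ideal_def[OF vr] PR max_ideal_def mem \<sigma>.hom_eq_0_iff flip: \<sigma>.hom_inverse)
  qed
  have "\<sigma> (X - const a) = X - const a'"
    by (simp add: \<sigma>.hom_diff s(3,4) \<tau>_def const.hom_diff)
  then have a': "X - const a' \<in> \<sigma> ` P"
    using mem[of "X - const a" P] aP by (simp add: PR)
  have c\<tau>: "const \<tau> = const a - const a'"
    by (simp add: \<tau>_def const.hom_diff)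
  have c\<delta>: "const \<delta> = const b - const b' - const a' * const (T \<tau>)"
    by (simp add: \<delta>_def const.hom_diff const.hom_mult)
  \<comment> \<open>The multiple of \<open>X - const a\<close> is subtracted to cancel the term
    \<open>X * const (T \<tau>)\<close> of \<open>\<sigma> y\<close>.\<close>
  have "\<sigma> ((y - const b) - const (T \<tau>) * (X - const a)) = y - const b'"
    unfolding \<sigma>.hom_diff \<sigma>.hom_mult s(3,4,5) c\<tau> c\<delta> by (simp add: algebra_simps)
  moreover have "const (T \<tau>) \<in> R"
    using const_in_KE KR by blast
  then have "(y - const b) - const (T \<tau>) * (X - const a) \<in> P"
    unfolding PR by (intro max_ideal_diff[OF bP] max_ideal_mult[OF _ aP])
  ultimately have b': "y - const b' \<in> \<sigma> ` P"
    by (metis imageI)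
  have "KE emb \<subseteq> \<sigma> ` R"
  proof
    fix z assume z: "z \<in> KE emb"
    then obtain c where "z = \<sigma> (const c)"
      by (auto simp: KE_def s(3))
    then show "z \<in> \<sigma> ` R"
      using KR const_in_KE[of c] by blast
  qed
  then have pr: "point_ring a' b' (\<sigma> ` R)"
    using vr a' b' by (simp add: point_ring_def mi)
  \<comment> \<open>Both are valuation rings at the point \<open>(a', b')\<close>, and smoothness
    leaves just one.\<close>
  have "\<sigma> ` R = val_ring P'"
    using point_ring_subset[OF ab'(1) pr ab'(2)] point_ring_subset[OF ab'(1) ab'(2) pr] by blast
  then have "\<sigma> ` P = P'"
    using mi place_ring(3)[OF pl(2)] by simp
  moreover have "\<sigma> \<in> Gamma q n emb y"
    unfolding Gamma_def using \<delta> \<sigma> by blast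
  ultimately show ?thesis
    by blast
qed

end

theorem theorem6p1:
  fixes q n :: nat
    and emb :: "'k::{field,finite} poly fract \<Rightarrow> 'e::field"
    and y :: 'e
  assumes q: "prime_power q"
    and n: "n \<ge> 2"
    and K: "card (UNIV :: 'k set) = q ^ n"
    and emb_add: "\<And>a b. emb (a + b) = emb a + emb b"
    and emb_mult: "\<And>a b. emb (a * b) = emb a * emb b"
    and emb_one: "emb 1 = 1"
    and gen: "\<And>L. is_subfield L \<Longrightarrow> range emb \<subseteq> L \<Longrightarrow> y \<in> L \<Longrightarrow> L = UNIV"
    and eqn: "addtr q n y = emb (s_n2 q n varF)"
  shows "(\<forall>\<tau> \<delta>. addtr q n \<delta> = s_n2 q n \<tau> \<longrightarrow> (\<exists>\<sigma>. is_sigma q n emb y \<tau> \<delta> \<sigma>))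
     \<and> (\<forall>\<sigma>\<in>Gamma q n emb y. \<sigma> ` range emb = range emb)
     \<and> id \<in> Gamma q n emb y
     \<and> (\<forall>\<sigma>\<in>Gamma q n emb y. \<forall>\<rho>\<in>Gamma q n emb y. \<sigma> \<circ> \<rho> \<in> Gamma q n emb y)
     \<and> (\<forall>\<sigma>\<in>Gamma q n emb y. inv \<sigma> \<in> Gamma q n emb y)
     \<and> card (Gamma q n emb y) = q ^ (2 * n - 1)
     \<and> (\<exists>!P. is_place (KE emb) P \<and>
          (\<exists>Q. is_place (range constF) Q \<and> varF \<notin> val_ring Q \<and> lies_over emb P Q))
     \<and> (\<forall>P P'. degree_one (KE emb) P \<and> degree_one (KE emb) P' \<and>
          \<not> (\<exists>Q. is_place (range constF) Q \<and> varF \<notin> val_ring Q \<and> lies_over emb P Q) \<and>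
          \<not> (\<exists>Q. is_place (range constF) Q \<and> varF \<notin> val_ring Q \<and> lies_over emb P' Q)
          \<longrightarrow> (\<exists>\<sigma>\<in>Gamma q n emb y. \<sigma> ` P = P'))"
proof -
  interpret tower q n emb y
    by (rule tower.intro[OF assms])
  show ?thesis
  proof (intro conjI allI ballI impI)
    show "\<exists>\<sigma>. is_sigma q n emb y \<tau> \<delta> \<sigma>" if "addtr q n \<delta> = s_n2 q n \<tau>" for \<tau> \<delta>
      using that by (rule exists_sigma)
    show "\<exists>\<sigma>\<in>Gamma q n emb y. \<sigma> ` P = P'"
      if "degree_one (KE emb) P \<and> degree_one (KE emb) P' \<and> \<not> over_pole P \<and> \<not> over_pole P'" for P P'
      using that by (intro Gamma_transitive) simp_all
  qed (simp_all only: Gamma_image id_in_Gamma comp_in_Gamma inv_in_Gamma card_Gamma ex1_over_pole)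
qed

end
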